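(* Let $0<\rho_*\le\rho^*<\infty$ and let $c_{\rm LSE}>0$ (depending only on $\rho_*,\rho^*$) and $C_{\rm LSE}>0$ be suitable constants. There exist constants $c_0,K>0$ depending only on $\rho_*$ such that the following holds. Suppose the LSE condition holds with constants $\rho_*,\rho^*,c_{\rm LSE},C_{\rm LSE}$ and radius $r$. Let $R=K(\|\boldsymbol\beta^*\|_2+\lambda\sqrt s)$ and suppose $$\|\nabla\mathcal L(\boldsymbol\beta_1)-\nabla\mathcal L(\boldsymbol\beta_2)\|_2\le\rho_c\|\boldsymbol\beta_1-\boldsymbol\beta_2\|_2\quad\text{for all }\boldsymbol\beta_1,\boldsymbol\beta_2\in B_2(R/2,\boldsymbol\beta^* ).$$ Suppose $4(\|\nabla\mathcal L(\boldsymbol\beta^* )\|_\infty+\varepsilon_c)\le\lambda\le c_0r/\sqrt s$ with $\varepsilon_c>0$. Then, to produce an approximate solution $\widetilde{\boldsymbol\beta}^{(1)}$ with $\omega_{\boldsymbol\lambda^{(0)}}(\widetilde{\boldsymbol\beta}^{(1)})\le\varepsilon_c$ in the contraction stage, the algorithm described in the context needs no more than $$\Big(\frac{(1+\gamma_u)R\rho_c}{\varepsilon_c}\Big)^2$$ LAMM iterations; i.e. there is $k\le((1+\gamma_u)R\rho_c/\varepsilon_c)^2$ with $\omega_{\boldsymbol\lambda^{(0)}}(\boldsymbol\beta^{(1,k)})\le\varepsilon_c$.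
   Context: Setting. $\boldsymbol\beta^*\in\mathbb R^d$ is the true parameter, $S=\mathrm{supp}(\boldsymbol\beta^* )$, $s=|S|\ge1$. $\mathbf v_I$ keeps the coordinates of $\mathbf v$ in $I$ and sets the others to $0$; $\odot$ is the entrywise product; $B_2(r,\boldsymbol\beta^* )=\{\boldsymbol\beta:\|\boldsymbol\beta-\boldsymbol\beta^*\|_2\le r\}$. The loss $\mathcal L:\mathbb R^d\to\mathbb R$ is convex, with continuous gradient that is differentiable on $B_2(r,\boldsymbol\beta^* )$. Localized sparse eigenvalues: $\rho_+(m,r)$ and $\rho_-(m,r)$ are the supremum and infimum of $\mathbf u_J^{T}\nabla^2\mathcal L(\boldsymbol\beta)\mathbf u_J$ over $\|\mathbf u_J\|_2=1$, $|J|\le m$, $\|\boldsymbol\beta-\boldsymbol\beta^*\|_2\le r$. LSE condition with constants $\rho_*,\rho^*,c_{\rm LSE},C_{\rm LSE}$ and radius $r$: there is an integer $\widetilde s\ge c_{\rm LSE}s$ with $0<\rho_*\le\rho_-(2s+2\widetilde s,r)<\rho_+(2s+2\widetilde s,r)\le\rho^*<\infty$ and $\rho_+(\widetilde s,r)/\rho_-(2s+2\widetilde s,r)\le1+C_{\rm LSE}\,\widetilde s/s$. Contraction stage. $\lambda>0$, $\boldsymbol\lambda^{(0)}=\lambda\mathbf 1\in\mathbb R^d$. For a weight vector $\boldsymbol\lambda$: $F(\boldsymbol\beta,\boldsymbol\lambda)=\mathcal L(\boldsymbol\beta)+\sum_j\lambda_j|\beta_j|$ and $\omega_{\boldsymbol\lambda}(\boldsymbol\beta)=\min_{\boldsymbol\xi\in\partial\|\boldsymbol\beta\|_1}\|\nabla\mathcal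 L(\boldsymbol\beta)+\boldsymbol\lambda\odot\boldsymbol\xi\|_\infty$. For $\phi>0$, $$\Psi_{\boldsymbol\lambda,\phi}(\boldsymbol\beta;\boldsymbol\beta')=\mathcal L(\boldsymbol\beta')+\langle\nabla\mathcal L(\boldsymbol\beta'),\boldsymbol\beta-\boldsymbol\beta'\rangle+\tfrac{\phi}{2}\|\boldsymbol\beta-\boldsymbol\beta'\|_2^2+\sum_j\lambda_j|\beta_j|,$$ whose unique minimizer in $\boldsymbol\beta$ is $T_{\boldsymbol\lambda,\phi}(\boldsymbol\beta')=\big(\mathrm{sign}(z_j)\max\{|z_j|-\lambda_j/\phi,0\}\big)_j$ with $\mathbf z=\boldsymbol\beta'-\phi^{-1}\nabla\mathcal L(\boldsymbol\beta')$. LAMM iteration (parameters $\gamma_u>1$ and a small $\phi_0>0$, in particular $\phi_0\le\rho_c$): start from $\boldsymbol\beta^{(1,0)}=\mathbf 0$, $\phi^{(1,0)}=\phi_0$. Given $\boldsymbol\beta^{(1,k-1)},\phi^{(1,k-1)}$, set $\phi=\max\{\phi_0,\gamma_u^{-1}\phi^{(1,k-1)}\}$ and repeatedly replace $\phi$ by $\gamma_u\phi$ until $\boldsymbol\beta=T_{\boldsymbol\lambda^{(0)},\phi}(\boldsymbol\beta^{(1,k-1)})$ satisfies $F(\boldsymbol\beta,\boldsymbol\lambda^{(0)})\le\Psi_{\boldsymbol\lambda^{(0)},\phi}(\boldsymbol\beta;\boldsymbol\beta^{(1,k-1)})$; then put $\boldsymbol\beta^{(1,k)}=\boldsymbol\beta$,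 $\phi^{(1,k)}=\phi$. Each passage from $\boldsymbol\beta^{(1,k-1)}$ to $\boldsymbol\beta^{(1,k)}$ counts as one LAMM iteration. The stage stops at the first $k$ with $\omega_{\boldsymbol\lambda^{(0)}}(\boldsymbol\beta^{(1,k)})\le\varepsilon_c$, and $\widetilde{\boldsymbol\beta}^{(1)}=\boldsymbol\beta^{(1,k)}$. *)

theory Defs
  imports "HOL-Analysis.Analysis" "HOL-Analysis.Finite_Function_Topology"
begin

text \<open>
  The constants in the theorem must not depend on the dimension \<open>d\<close>, so \<open>d\<close> is
  quantified inside the statement and \<open>\<real>\<^sup>d\<close> is the subspace \<open>Rd d\<close> of the finitely supported
  sequences \<open>nat \<Rightarrow>\<^sub>0 real\<close>, with coordinates \<open>0, \<dots>, d - 1\<close>. The library \<open>norm\<close> of this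
  type is the \<open>\<ell>\<^sub>1\<close> norm; it enters below only through limits (continuity and Frechet
  derivatives within \<open>Rd d\<close>), which on a fixed \<open>Rd d\<close> are those of the Euclidean norm because all
  norms on \<open>\<real>\<^sup>d\<close> are equivalent. The norms of the statement are \<open>l2_norm\<close>, \<open>l1_norm\<close> and
  \<open>linf_norm\<close>. Functions on \<open>\<real>\<^sup>d\<close> are functions on the whole type of which only the
  values on \<open>Rd d\<close> matter.
\<close>

type_synonym rvec = "nat \<Rightarrow>\<^sub>0 real"

abbreviation coord :: "rvec \<Rightarrow> nat \<Rightarrow> real" where
  "coord \<equiv> Poly_Mapping.lookup"

abbreviation supp :: "rvec \<Rightarrow> nat set" where
  "supp \<equiv> Poly_Mapping.keys"

definition Rd :: "nat \<Rightarrow> rvec set" where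
  "Rd d = {x. supp x \<subseteq> {..<d}}"

definition mk_vec :: "nat \<Rightarrow> (nat \<Rightarrow> real) \<Rightarrow> rvec" where
  "mk_vec d f = Abs_poly_mapping (\<lambda>i. if i < d then f i else 0)"

lemma coord_mk_vec [simp]: "coord (mk_vec d f) i = (if i < d then f i else 0)"
proof -
  have "finite {j. (if j < d then f j else 0) \<noteq> 0}"
    by (rule finite_subset [of _ "{..<d}"]) (auto split: if_splits)
  then show ?thesis
    by (simp add: mk_vec_def lookup_Abs_poly_mapping)
qed

lemma mk_vec_in_Rd [simp]: "mk_vec d f \<in> Rd d"
  by (auto simp: Rd_def in_keys_iff split: if_splits)

definition ip :: "nat \<Rightarrow> rvec \<Rightarrow> rvec \<Rightarrow> real" where
  "ip d x y = (\<Sum>i<d. coord x i * coord y i)"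

definition l2_norm :: "nat \<Rightarrow> rvec \<Rightarrow> real" where
  "l2_norm d x = L2_set (coord x) {..<d}"

definition l1_norm :: "nat \<Rightarrow> rvec \<Rightarrow> real" where
  "l1_norm d x = (\<Sum>i<d. \<bar>coord x i\<bar>)"

text \<open>Only meaningful for \<open>d > 0\<close>.\<close>

definition linf_norm :: "nat \<Rightarrow> rvec \<Rightarrow> real" where
  "linf_norm d x = Max ((\<lambda>i. \<bar>coord x i\<bar>) ` {..<d})"

definition restr :: "nat \<Rightarrow> nat set \<Rightarrow> rvec \<Rightarrow> rvec" where
  "restr d I v = mk_vec d (\<lambda>i. if i \<in> I then coord v i else 0)"

definition hadamard :: "nat \<Rightarrow> rvec \<Rightarrow> rvec \<Rightarrow> rvec" where
  "hadamard d x y = mk_vec d (\<lambda>i. coord x i * coord y i)"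

definition const_vec :: "nat \<Rightarrow> real \<Rightarrow> rvec" where
  "const_vec d a = mk_vec d (\<lambda>_. a)"

definition B2 :: "nat \<Rightarrow> real \<Rightarrow> rvec \<Rightarrow> rvec set" where
  "B2 d r c = {x \<in> Rd d. l2_norm d (x - c) \<le> r}"

definition grad :: "nat \<Rightarrow> (rvec \<Rightarrow> real) \<Rightarrow> rvec \<Rightarrow> rvec" where
  "grad d L x = (THE g. g \<in> Rd d \<and> (L has_derivative ip d g) (at x within Rd d))"

text \<open>The Hessian as a linear map. Away from \<open>Rd d\<close> the library derivative is not
  determined, but its values on \<open>Rd d\<close> are.\<close>

definition hess :: "nat \<Rightarrow> (rvec \<Rightarrow> real) \<Rightarrow> rvec \<Rightarrow> rvec \<Rightarrow> rvec" where
  "hess d L x = frechet_derivative (grad d L) (at x within Rd d)"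

definition admissible_loss :: "nat \<Rightarrow> (rvec \<Rightarrow> real) \<Rightarrow> rvec \<Rightarrow> real \<Rightarrow> bool" where
  "admissible_loss d L bstar r \<longleftrightarrow>
     convex_on (Rd d) L \<and>
     L differentiable_on Rd d \<and>
     continuous_on (Rd d) (grad d L) \<and>
     (\<forall>x \<in> B2 d r bstar. grad d L differentiable (at x within Rd d))"

definition sparse_forms ::
  "nat \<Rightarrow> (rvec \<Rightarrow> real) \<Rightarrow> rvec \<Rightarrow> nat \<Rightarrow> real \<Rightarrow> real set" where
  "sparse_forms d L bstar m r =
     {ip d (restr d J u) (hess d L x (restr d J u)) | u J x.
        u \<in> Rd d \<and> J \<subseteq> {..<d} \<and> card J \<le> m \<and> l2_norm d (restr d J u) = 1 \<and> x \<in> B2 d r bstar}"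

text \<open>Extended-real valued, as the supremum may be infinite.\<close>

definition rho_plus ::
  "nat \<Rightarrow> (rvec \<Rightarrow> real) \<Rightarrow> rvec \<Rightarrow> nat \<Rightarrow> real \<Rightarrow> ereal" where
  "rho_plus d L bstar m r = (SUP q \<in> sparse_forms d L bstar m r. ereal q)"

definition rho_minus ::
  "nat \<Rightarrow> (rvec \<Rightarrow> real) \<Rightarrow> rvec \<Rightarrow> nat \<Rightarrow> real \<Rightarrow> ereal" where
  "rho_minus d L bstar m r = (INF q \<in> sparse_forms d L bstar m r. ereal q)"

definition LSE ::
  "nat \<Rightarrow> (rvec \<Rightarrow> real) \<Rightarrow> rvec \<Rightarrow> real \<Rightarrow> real \<Rightarrow> real \<Rightarrow> real \<Rightarrow> real \<Rightarrow> bool" where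
  "LSE d L bstar rho_lo rho_up c C r \<longleftrightarrow>
     (let s = card (supp bstar) in
      \<exists>t::nat. c * real s \<le> real t \<and>
        0 < rho_lo \<and>
        ereal rho_lo \<le> rho_minus d L bstar (2 * s + 2 * t) r \<and>
        rho_minus d L bstar (2 * s + 2 * t) r < rho_plus d L bstar (2 * s + 2 * t) r \<and>
        rho_plus d L bstar (2 * s + 2 * t) r \<le> ereal rho_up \<and>
        rho_plus d L bstar t r / rho_minus d L bstar (2 * s + 2 * t) r
          \<le> ereal (1 + C * real t / real s))"

definition subdiff :: "nat \<Rightarrow> (rvec \<Rightarrow> real) \<Rightarrow> rvec \<Rightarrow> rvec set" where
  "subdiff d f x = {g \<in> Rd d. \<forall>y \<in> Rd d. f x + ip d g (y - x) \<le> f y}"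

definition weighted_l1 :: "nat \<Rightarrow> rvec \<Rightarrow> rvec \<Rightarrow> real" where
  "weighted_l1 d w x = (\<Sum>j<d. coord w j * \<bar>coord x j\<bar>)"

definition obj :: "nat \<Rightarrow> (rvec \<Rightarrow> real) \<Rightarrow> rvec \<Rightarrow> rvec \<Rightarrow> real" where
  "obj d L x w = L x + weighted_l1 d w x"

text \<open>The infimum is a minimum: the subdifferential of the \<open>\<ell>\<^sub>1\<close> norm is nonempty and
  compact.\<close>

definition omega :: "nat \<Rightarrow> (rvec \<Rightarrow> real) \<Rightarrow> rvec \<Rightarrow> rvec \<Rightarrow> real" where
  "omega d L w x =
     (INF xi \<in> subdiff d (l1_norm d) x. linf_norm d (grad d L x + hadamard d w xi))"

definition Psi ::
  "nat \<Rightarrow> (rvec \<Rightarrow> real) \<Rightarrow> rvec \<Rightarrow> real \<Rightarrow> rvec \<Rightarrow> rvec \<Rightarrow> real" where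
  "Psi d L w phi x x' =
     L x' + ip d (grad d L x') (x - x') + phi / 2 * (l2_norm d (x - x'))\<^sup>2 + weighted_l1 d w x"

definition T_step ::
  "nat \<Rightarrow> (rvec \<Rightarrow> real) \<Rightarrow> rvec \<Rightarrow> real \<Rightarrow> rvec \<Rightarrow> rvec" where
  "T_step d L w phi x' =
     (let z = x' - (1 / phi) *\<^sub>R grad d L x' in
      mk_vec d (\<lambda>j. sgn (coord z j) * max (\<bar>coord z j\<bar> - coord w j / phi) 0))"

definition majorizes ::
  "nat \<Rightarrow> (rvec \<Rightarrow> real) \<Rightarrow> rvec \<Rightarrow> rvec \<Rightarrow> real \<Rightarrow> bool" where
  "majorizes d L w x' phi \<longleftrightarrow>
     obj d L (T_step d L w phi x') w \<le> Psi d L w phi (T_step d L w phi x') x'"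

text \<open>\<open>lamm d L w gamma phi0 k x phi\<close>: the algorithm completes its first \<open>k\<close> iterations and
  then holds the iterate \<open>x\<close> and the quadratic coefficient \<open>phi\<close>. In \<open>step\<close>, \<open>j\<close> is the
  number of times the coefficient is inflated; if the inner search does not terminate,
  no further iterate is derivable.\<close>

inductive lamm ::
  "nat \<Rightarrow> (rvec \<Rightarrow> real) \<Rightarrow> rvec \<Rightarrow> real \<Rightarrow> real \<Rightarrow> nat \<Rightarrow> rvec \<Rightarrow> real \<Rightarrow> bool"
  for d :: nat and L :: "rvec \<Rightarrow> real" and w :: rvec and gamma phi0 :: real
where
  init: "lamm d L w gamma phi0 0 0 phi0"
| step: "lamm d L w gamma phi0 k x phi \<Longrightarrow>
         start = max phi0 (phi / gamma) \<Longrightarrow>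
         \<forall>i<j. \<not> majorizes d L w x (start * gamma ^ i) \<Longrightarrow>
         majorizes d L w x (start * gamma ^ j) \<Longrightarrow>
         lamm d L w gamma phi0 (Suc k) (T_step d L w (start * gamma ^ j) x) (start * gamma ^ j)"

end

theory Submission
  imports Defs
begin

text \<open>
  Why the iteration stops in time. Write \<open>F = L + \<lambda> * l1_norm\<close>.

  \<^emph>\<open>A minimizer near the target.\<close> At a point where \<open>F\<close> does not exceed its value at \<open>bstar\<close>, the
  deviation from \<open>bstar\<close> lies in the cone where its \<open>\<ell>\<^sub>1\<close> norm off the support \<open>S\<close> is at most three
  times the one on \<open>S\<close> (\<open>sublevel_in_cone\<close>). On this cone sparse eigenvalues control the whole
  Hessian form: cutting the vector into blocks of decreasing size shows that all but the
  largest coordinates are negligible (\<open>shelling\<close>, \<open>restricted_eigenvalue\<close>). The loss is thus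
  strongly convex on the relevant deviations, with a constant proportional to \<open>rho_lo\<close>, and \<open>F\<close>
  has a minimizer \<open>m\<close> within \<open>O(\<lambda> sqrt s / rho_lo)\<close> of \<open>bstar\<close> (\<open>exists_minimizer_near_target\<close>). So
  \<open>l2_norm m\<close>, the distance of the starting point to \<open>m\<close>, is at most \<open>R / 6\<close> for suitable \<open>K\<close>.

  \<^emph>\<open>The iterates stay in the ball.\<close> An accepted step satisfies the fundamental inequality of
  proximal gradient methods (\<open>step_inequality\<close>), by which the distance to \<open>m\<close> does not increase. A
  trial step whose coefficient is at least \<open>rho_c\<close> at most doubles the distance, as a
  comparison of optimality conditions shows (\<open>step_dist_le\<close>); so it lands in the ball of radius \<open>R / 2\<close>, the Lipschitz
  condition applies, and it is accepted. Hence accepted coefficients are at most \<open>gamma_u * rho_c\<close>.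

  \<^emph>\<open>The rate.\<close> The residual after a step with coefficient \<open>\<phi>\<close> is at most \<open>rho_c + \<phi>\<close> times the length
  of the step (\<open>omega_step_le\<close>), and the squared lengths of the steps sum to at most a multiple,
  depending on \<open>gamma_u\<close>, of the squared distance of the origin to \<open>m\<close>. This is proved with a
  potential that combines the squared distance to \<open>m\<close> and the gap of \<open>F\<close> divided by the coefficient
  (\<open>potential_decrease\<close>). Steps with coefficients far above \<open>rho_c\<close> are estimated by the decrease
  of the distance instead (\<open>omega_square_estimate_arith\<close>), which gives the right dependence on
  \<open>gamma_u\<close>: the sum of the squared residuals is at most \<open>9 * ((1 + gamma_u) * rho_c * l2_norm m)\<^sup>2\<close>, so
  not all of them can exceed \<open>eps_c\<^sup>2\<close> for as many iterations as the bound allows.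
\<close>

section \<open>Euclidean geometry of finitely supported vectors\<close>

lemma coord_scaleR [simp]: "coord (a *\<^sub>R x) i = a * coord x i"
proof -
  have "finite {i. a * coord x i \<noteq> 0}"
    by (rule finite_subset [of _ "supp x"]) (auto simp: in_keys_iff)
  then show ?thesis
    by (simp add: scaleR_poly_mapping_def lookup_Abs_poly_mapping)
qed

lemma Rd_iff: "x \<in> Rd d \<longleftrightarrow> (\<forall>i\<ge>d. coord x i = 0)"
  by (auto simp: Rd_def in_keys_iff subset_iff not_le [symmetric])

lemma Rd_add [simp]: "x \<in> Rd d \<Longrightarrow> y \<in> Rd d \<Longrightarrow> x + y \<in> Rd d"
  and Rd_diff [simp]: "x \<in> Rd d \<Longrightarrow> y \<in> Rd d \<Longrightarrow> x - y \<in> Rd d"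
  and Rd_scaleR [simp]: "x \<in> Rd d \<Longrightarrow> a *\<^sub>R x \<in> Rd d"
  and Rd_zero [simp]: "0 \<in> Rd d"
  by (auto simp: Rd_iff lookup_add lookup_minus)

lemma restr_Rd [simp]: "restr d I v \<in> Rd d"
  by (simp add: restr_def)

lemma coord_restr [simp]: "coord (restr d I v) i = (if i < d \<and> i \<in> I then coord v i else 0)"
  by (simp add: restr_def)

lemma coord_const_vec [simp]: "coord (const_vec d a) i = (if i < d then a else 0)"
  by (simp add: const_vec_def)

lemma coord_hadamard [simp]:
  "coord (hadamard d x y) i = (if i < d then coord x i * coord y i else 0)"
  by (simp add: hadamard_def)

lemma Rd_eqI:
  assumes "x \<in> Rd d" "y \<in> Rd d" "\<And>i. i < d \<Longrightarrow> coord x i = coord y i"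
  shows "x = y"
  by (rule poly_mapping_eqI) (metis Rd_iff assms not_le)

lemma ip_commute: "ip d x y = ip d y x"
  by (simp add: ip_def mult.commute)

lemma ip_add_left: "ip d (x + y) z = ip d x z + ip d y z"
  and ip_add_right: "ip d z (x + y) = ip d z x + ip d z y"
  and ip_diff_left: "ip d (x - y) z = ip d x z - ip d y z"
  and ip_diff_right: "ip d z (x - y) = ip d z x - ip d z y"
  and ip_scaleR_left [simp]: "ip d (a *\<^sub>R x) z = a * ip d x z"
  and ip_scaleR_right [simp]: "ip d z (a *\<^sub>R x) = a * ip d z x"
  and ip_zero_left [simp]: "ip d 0 z = 0"
  and ip_zero_right [simp]: "ip d z 0 = 0"
  by (simp_all add: ip_def lookup_add lookup_minus algebra_simps sum.distrib sum_subtractf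
      sum_distrib_left)

lemmas ip_bilinear = ip_add_left ip_add_right ip_diff_left ip_diff_right

lemma l2_norm_square: "(l2_norm d x)\<^sup>2 = ip d x x"
  by (simp add: l2_norm_def L2_set_def ip_def sum_nonneg power2_eq_square)

lemma l2_norm_nonneg [simp]: "0 \<le> l2_norm d x"
  by (simp add: l2_norm_def)

lemma l2_norm_zero [simp]: "l2_norm d 0 = 0"
  by (simp add: l2_norm_def L2_set_def)

lemma ip_le_l2_norm: "\<bar>ip d x y\<bar> \<le> l2_norm d x * l2_norm d y"
proof -
  have "\<bar>ip d x y\<bar> \<le> (\<Sum>i<d. \<bar>coord x i\<bar> * \<bar>coord y i\<bar>)"
    unfolding ip_def by (rule order_trans [OF sum_abs]) (simp add: abs_mult)
  also have "\<dots> \<le> l2_norm d x * l2_norm d y"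
    unfolding l2_norm_def by (rule L2_set_mult_ineq)
  finally show ?thesis .
qed

lemma l2_norm_triangle: "l2_norm d (x + y) \<le> l2_norm d x + l2_norm d y"
  unfolding l2_norm_def using L2_set_triangle_ineq [of "coord x" "coord y"]
  by (simp add: lookup_add L2_set_def)

lemma l2_norm_scaleR [simp]: "l2_norm d (a *\<^sub>R x) = \<bar>a\<bar> * l2_norm d x"
proof -
  have "(l2_norm d (a *\<^sub>R x))\<^sup>2 = (\<bar>a\<bar> * l2_norm d x)\<^sup>2"
    by (simp add: l2_norm_square power_mult_distrib) (simp add: power2_eq_square)
  then show ?thesis
    by (rule power2_eq_imp_eq) simp_all
qed

lemma l2_norm_minus_commute: "l2_norm d (x - y) = l2_norm d (y - x)"
  using l2_norm_scaleR [of d "-1" "x - y"] by simp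

lemma l2_norm_diff_triangle: "l2_norm d (x - z) \<le> l2_norm d (x - y) + l2_norm d (y - z)"
  using l2_norm_triangle [of d "x - y" "y - z"] by simp

lemma coord_le_l2_norm:
  assumes "i < d"
  shows "\<bar>coord x i\<bar> \<le> l2_norm d x"
  using member_le_L2_set [of "{..<d}" i "\<lambda>i. \<bar>coord x i\<bar>"] assms
  by (simp add: l2_norm_def L2_set_def)

lemma l2_norm_eq_0_iff:
  assumes "x \<in> Rd d"
  shows "l2_norm d x = 0 \<longleftrightarrow> x = 0"
proof
  assume "l2_norm d x = 0"
  then show "x = 0"
    using assms coord_le_l2_norm [of _ d x] by (intro Rd_eqI [of _ d]) fastforce+
qed simp

lemma linf_norm_le_iff:
  assumes "0 < d"
  shows "linf_norm d x \<le> a \<longleftrightarrow> (\<forall>i<d. \<bar>coord x i\<bar> \<le> a)"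
  unfolding linf_norm_def using assms by (subst Max_le_iff) auto

lemma coord_le_linf_norm: "i < d \<Longrightarrow> \<bar>coord x i\<bar> \<le> linf_norm d x"
  unfolding linf_norm_def by (rule Max_ge) auto

lemma linf_norm_nonneg: "0 < d \<Longrightarrow> 0 \<le> linf_norm d x"
  using coord_le_linf_norm [of 0 d x] by linarith

lemma ip_le_linf_l1: "\<bar>ip d g x\<bar> \<le> linf_norm d g * l1_norm d x"
proof -
  have "\<bar>ip d g x\<bar> \<le> (\<Sum>i<d. \<bar>coord g i\<bar> * \<bar>coord x i\<bar>)"
    unfolding ip_def by (rule order_trans [OF sum_abs]) (simp add: abs_mult)
  also have "\<dots> \<le> (\<Sum>i<d. linf_norm d g * \<bar>coord x i\<bar>)"
    by (intro sum_mono mult_right_mono coord_le_linf_norm) auto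
  finally show ?thesis
    by (simp add: l1_norm_def sum_distrib_left)
qed

lemma l1_norm_nonneg [simp]: "0 \<le> l1_norm d x"
  by (simp add: l1_norm_def sum_nonneg)

lemma weighted_l1_const: "weighted_l1 d (const_vec d lam) x = lam * l1_norm d x"
  by (simp add: weighted_l1_def l1_norm_def sum_distrib_left)

lemma l1_norm_scaleR [simp]: "l1_norm d (a *\<^sub>R x) = \<bar>a\<bar> * l1_norm d x"
  by (simp add: l1_norm_def abs_mult sum_distrib_left)

lemma l1_norm_triangle: "l1_norm d (x + y) \<le> l1_norm d x + l1_norm d y"
  unfolding l1_norm_def sum.distrib [symmetric]
  by (intro sum_mono) (simp add: lookup_add)

lemma restr_zero [simp]: "restr d {} v = 0"
  by (rule poly_mapping_eqI) simp

lemma restr_disjoint_union: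
  "A \<inter> B = {} \<Longrightarrow> restr d (A \<union> B) v = restr d A v + restr d B v"
  by (rule poly_mapping_eqI) (auto simp: lookup_add)

lemma restr_all: "v \<in> Rd d \<Longrightarrow> {..<d} \<subseteq> A \<Longrightarrow> restr d A v = v"
  by (rule Rd_eqI [of _ d]) auto

lemma l1_norm_restr_eq:
  "A \<subseteq> {..<d} \<Longrightarrow> l1_norm d (restr d A v) = (\<Sum>i\<in>A. \<bar>coord v i\<bar>)"
  unfolding l1_norm_def by (rule sum.mono_neutral_cong_right) auto

lemma l1_norm_restr_disjoint_union:
  "A \<inter> B = {} \<Longrightarrow>
    l1_norm d (restr d (A \<union> B) v) = l1_norm d (restr d A v) + l1_norm d (restr d B v)"
  unfolding l1_norm_def sum.distrib [symmetric] by (intro sum.cong) auto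

lemma l2_norm_restr_eq:
  "A \<subseteq> {..<d} \<Longrightarrow> l2_norm d (restr d A v) = L2_set (coord v) A"
  unfolding l2_norm_def L2_set_def
  by (intro arg_cong [of _ _ sqrt] sum.mono_neutral_cong_right) auto

lemma l2_norm_restr_mono: "A \<subseteq> B \<Longrightarrow> l2_norm d (restr d A v) \<le> l2_norm d (restr d B v)"
  unfolding l2_norm_def L2_set_def by (intro real_sqrt_le_mono sum_mono) auto

lemma l1_norm_restr_le_l2_norm:
  assumes "A \<subseteq> {..<d}"
  shows "l1_norm d (restr d A v) \<le> sqrt (card A) * l2_norm d (restr d A v)"
  using L2_set_mult_ineq [of "coord v" "\<lambda>_. 1" A]
  by (simp add: assms l1_norm_restr_eq l2_norm_restr_eq L2_set_constant mult.commute)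


section \<open>Limits and compactness in a fixed dimension\<close>

lemma coord_le_norm: "\<bar>coord x i\<bar> \<le> norm (x :: rvec)"
proof (cases "i \<in> supp x")
  case True
  then have "\<bar>coord x i\<bar> \<le> (\<Sum>n\<in>supp x. \<bar>coord x n\<bar>)"
    by (intro member_le_sum) auto
  then show ?thesis
    by (simp add: norm_poly_mapping_def dist_poly_mapping_def)
qed (simp add: in_keys_iff)

lemma bounded_linear_coord: "bounded_linear (\<lambda>x :: rvec. coord x i)"
  by (rule bounded_linear_intro [of _ 1]) (auto simp: lookup_add coord_le_norm)

lemmas continuous_on_coord [continuous_intros] =
  bounded_linear.continuous_on [OF bounded_linear_coord]

lemma bounded_linear_ip: "bounded_linear (ip d g)"
  unfolding ip_def
  by (intro bounded_linear_sum bounded_linear_const_mult bounded_linear_coord)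

lemma bounded_linear_ip_left: "bounded_linear (\<lambda>x. ip d x v)"
proof -
  have "(\<lambda>x. ip d x v) = ip d v"
    by (rule ext) (rule ip_commute)
  then show ?thesis
    by (simp add: bounded_linear_ip)
qed

lemma continuous_on_l2_norm [continuous_intros]:
  "continuous_on A f \<Longrightarrow> continuous_on A (\<lambda>x. l2_norm d (f x))"
  unfolding l2_norm_def L2_set_def by (intro continuous_intros)

lemma continuous_on_l1_norm [continuous_intros]:
  "continuous_on A f \<Longrightarrow> continuous_on A (\<lambda>x. l1_norm d (f x))"
  unfolding l1_norm_def by (intro continuous_intros)

lemma compact_box: "compact {x \<in> Rd d. \<forall>i<d. \<bar>coord x i\<bar> \<le> M}"
proof (induction d)
  case 0
  have "{x \<in> Rd 0. \<forall>i<0. \<bar>coord x i\<bar> \<le> M} = {0}"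
    by (auto simp: Rd_iff intro: poly_mapping_eqI)
  then show ?case by simp
next
  case (Suc d)
  let ?e = "Poly_Mapping.single d (1 :: real)"
  let ?B = "{x \<in> Rd d. \<forall>i<d. \<bar>coord x i\<bar> \<le> M}"
  have "compact ((\<lambda>p. fst p + snd p *\<^sub>R ?e) ` (?B \<times> {-M..M}))"
    by (intro compact_continuous_image compact_Times Suc compact_Icc continuous_intros)
  also have "(\<lambda>p. fst p + snd p *\<^sub>R ?e) ` (?B \<times> {-M..M}) =
      {x \<in> Rd (Suc d). \<forall>i<Suc d. \<bar>coord x i\<bar> \<le> M}"
  proof (intro equalityI subsetI)
    fix x assume x: "x \<in> {x \<in> Rd (Suc d). \<forall>i<Suc d. \<bar>coord x i\<bar> \<le> M}"
    have "x = restr d UNIV x + coord x d *\<^sub>R ?e"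
      using x by (intro Rd_eqI [of _ "Suc d"])
        (auto simp: Rd_iff lookup_add lookup_single when_def less_Suc_eq)
    moreover have "(restr d UNIV x, coord x d) \<in> ?B \<times> {-M..M}"
      using x by (auto simp: abs_le_iff minus_le_iff)
    ultimately show "x \<in> (\<lambda>p. fst p + snd p *\<^sub>R ?e) ` (?B \<times> {-M..M})"
      by (intro image_eqI [where x = "(restr d UNIV x, coord x d)"]) auto
  qed (auto simp: Rd_iff lookup_add lookup_single when_def less_Suc_eq abs_le_iff)
  finally show ?case .
qed

lemma compact_B2: "compact (B2 d r c)"
proof -
  let ?M = "r + l2_norm d c"
  have "B2 d r c = {x \<in> Rd d. \<forall>i<d. \<bar>coord x i\<bar> \<le> ?M} \<inter> {x. l2_norm d (x - c) \<le> r}"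
    unfolding B2_def
  proof (intro equalityI subsetI; clarsimp)
    fix x i assume "l2_norm d (x - c) \<le> r" "i < d"
    then show "\<bar>coord x i\<bar> \<le> ?M"
      using coord_le_l2_norm [of i d x] l2_norm_triangle [of d "x - c" c] by simp
  qed
  moreover have "closed {x. l2_norm d (x - c) \<le> r}"
    by (intro closed_Collect_le continuous_intros)
  ultimately show ?thesis
    by (simp add: compact_box compact_Int_closed)
qed


section \<open>Differentiable convex losses\<close>

text \<open>
  The derivative within the subspace, followed along a line of the subspace, is an ordinary
  one-variable derivative; all inequalities below are one-variable calculus on such lines.
\<close>

lemma has_derivative_on_line:
  fixes f :: "rvec \<Rightarrow> 'b :: real_normed_vector"
  assumes f: "(f has_derivative f') (at (x + t *\<^sub>R h) within Rd d)"
    and xh: "x \<in> Rd d" "h \<in> Rd d"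
  shows "((\<lambda>\<tau>. f (x + \<tau> *\<^sub>R h)) has_derivative (\<lambda>\<tau>. f' (\<tau> *\<^sub>R h))) (at t)"
proof (rule has_derivative_in_compose
    [where f = "\<lambda>\<tau>. x + \<tau> *\<^sub>R h" and f' = "\<lambda>\<tau>. \<tau> *\<^sub>R h" and g = f and g' = f'])
  show "((\<lambda>\<tau>. x + \<tau> *\<^sub>R h) has_derivative (\<lambda>\<tau>. \<tau> *\<^sub>R h)) (at t)"
    by (auto intro!: derivative_eq_intros)
  show "(f has_derivative f') (at (x + t *\<^sub>R h) within range (\<lambda>\<tau>. x + \<tau> *\<^sub>R h))"
    using f by (rule has_derivative_subset) (use xh in auto)
qed

lemma has_derivative_on_line_ip:
  assumes f: "(f has_derivative ip d g) (at (x + t *\<^sub>R h) within Rd d)"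
    and xh: "x \<in> Rd d" "h \<in> Rd d"
  shows "((\<lambda>\<tau>. f (x + \<tau> *\<^sub>R h)) has_real_derivative ip d g h) (at t)"
proof -
  have "(\<lambda>\<tau>. ip d g (\<tau> *\<^sub>R h)) = (*) (ip d g h)"
    by (rule ext) simp
  then show ?thesis
    using has_derivative_on_line [OF assms] by (simp only: has_field_derivative_def)
qed

definition axis_vec :: "nat \<Rightarrow> rvec" where
  "axis_vec i = Poly_Mapping.single i 1"

lemma axis_vec_Rd [simp]: "i < d \<Longrightarrow> axis_vec i \<in> Rd d"
  by (auto simp: Rd_iff axis_vec_def lookup_single when_def)

lemma ip_axis_vec [simp]: "i < d \<Longrightarrow> ip d g (axis_vec i) = coord g i"
  by (simp add: ip_def axis_vec_def lookup_single when_def if_distrib cong: if_cong)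

lemma axis_vec_expansion:
  assumes "v \<in> Rd d"
  shows "v = (\<Sum>i<d. coord v i *\<^sub>R axis_vec i)"
proof (rule poly_mapping_eqI)
  fix k
  have "coord (\<Sum>i<d. coord v i *\<^sub>R axis_vec i) k = (\<Sum>i<d. coord (coord v i *\<^sub>R axis_vec i) k)"
    by (rule lookup_sum)
  also have "\<dots> = coord v k"
    using assms by (auto simp: Rd_iff axis_vec_def lookup_single when_def if_distrib cong: if_cong)
  finally show "coord v k = coord (\<Sum>i<d. coord v i *\<^sub>R axis_vec i) k" ..
qed

locale smooth_convex =
  fixes d :: nat and L :: "rvec \<Rightarrow> real"
  assumes convex_L: "convex_on (Rd d) L"
    and differentiable_L: "L differentiable_on Rd d"
begin

abbreviation G :: "rvec \<Rightarrow> rvec" where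
  "G \<equiv> grad d L"

lemma has_gradient:
  assumes x: "x \<in> Rd d"
  shows "G x \<in> Rd d \<and> (L has_derivative ip d (G x)) (at x within Rd d)"
proof -
  obtain D where D: "(L has_derivative D) (at x within Rd d)"
    using differentiable_L x by (auto simp: differentiable_on_def differentiable_def)
  then have lin: "linear D"
    by (simp add: has_derivative_linear)
  define g where "g = mk_vec d (\<lambda>i. D (axis_vec i))"
  have Dg: "D v = ip d g v" if "v \<in> Rd d" for v
  proof -
    have "D v = (\<Sum>i<d. coord v i * D (axis_vec i))"
      by (subst axis_vec_expansion [OF that]) (simp add: linear_sum [OF lin] linear_scale [OF lin])
    then show ?thesis
      by (simp add: ip_def g_def mult.commute)
  qed
  have grad_g: "(L has_derivative ip d g) (at x within Rd d)"
  proof -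
    have "((\<lambda>y. (L y - L x - D (y - x)) /\<^sub>R norm (y - x)) \<longlongrightarrow> 0) (at x within Rd d)"
      using D by (simp add: has_derivative_at_within)
    then have "((\<lambda>y. (L y - L x - ip d g (y - x)) /\<^sub>R norm (y - x)) \<longlongrightarrow> 0) (at x within Rd d)"
      by (rule Lim_transform_eventually) (auto simp: eventually_at_filter Dg x)
    then show ?thesis
      by (simp add: has_derivative_at_within bounded_linear_ip)
  qed
  have "g' = g"
    if g': "g' \<in> Rd d" "(L has_derivative ip d g') (at x within Rd d)" for g'
  proof (rule Rd_eqI [of _ d])
    fix i assume i: "i < d"
    have deriv: "((\<lambda>\<tau>. L (x + \<tau> *\<^sub>R axis_vec i)) has_real_derivative coord g'' i) (at 0)"
      if "(L has_derivative ip d g'') (at x within Rd d)" for g''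
      using has_derivative_on_line_ip [of L d g'' x 0 "axis_vec i"] that x i by simp
    show "coord g' i = coord g i"
      using deriv [OF g'(2)] deriv [OF grad_g] by (rule DERIV_unique)
  qed (simp_all add: g' g_def)
  then show ?thesis
    unfolding grad_def
    using theI [of "\<lambda>g. g \<in> Rd d \<and> (L has_derivative ip d g) (at x within Rd d)" g] grad_g
    by (simp add: g_def)
qed

lemma G_Rd [simp]: "x \<in> Rd d \<Longrightarrow> G x \<in> Rd d"
  using has_gradient by blast

lemma DERIV_L_line:
  assumes "x \<in> Rd d" "h \<in> Rd d"
  shows "((\<lambda>\<tau>. L (x + \<tau> *\<^sub>R h)) has_real_derivative ip d (G (x + t *\<^sub>R h)) h) (at t)"
  using has_gradient [of "x + t *\<^sub>R h"] assms by (intro has_derivative_on_line_ip) auto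

lemma convex_on_line:
  assumes "x \<in> Rd d" "h \<in> Rd d"
  shows "convex_on UNIV (\<lambda>\<tau>. L (x + \<tau> *\<^sub>R h))"
proof (rule convex_onI)
  fix t a b :: real
  assume t: "0 < t" "t < 1"
  have "x + ((1 - t) *\<^sub>R a + t *\<^sub>R b) *\<^sub>R h = (1 - t) *\<^sub>R (x + a *\<^sub>R h) + t *\<^sub>R (x + b *\<^sub>R h)"
    by (simp add: algebra_simps)
  then show "L (x + ((1 - t) *\<^sub>R a + t *\<^sub>R b) *\<^sub>R h)
      \<le> (1 - t) * L (x + a *\<^sub>R h) + t * L (x + b *\<^sub>R h)"
    using convex_onD [OF convex_L, of t "x + a *\<^sub>R h" "x + b *\<^sub>R h"] t assms by simp
qed simp

lemma gradient_inequality: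
  assumes "x \<in> Rd d" "y \<in> Rd d"
  shows "L x + ip d (G x) (y - x) \<le> L y"
  using convex_on_imp_above_tangent
    [OF convex_on_line [of x "y - x"] connected_UNIV, of 0 1 "ip d (G x) (y - x)"]
    DERIV_L_line [of x "y - x" 0] assms by simp

lemma gradient_monotone:
  assumes "x \<in> Rd d" "y \<in> Rd d"
  shows "0 \<le> ip d (G y - G x) (y - x)"
  using gradient_inequality [of x y] gradient_inequality [of y x] assms
  by (simp add: ip_bilinear)

text \<open>
  A bound on the increments of the gradient along a segment integrates to a quadratic bound
  on the loss: upwards with a Lipschitz gradient, downwards with strong monotonicity.
\<close>

lemma quadratic_upper_bound:
  assumes xy: "x \<in> Rd d" "y \<in> Rd d"
    and grow: "\<And>t. 0 \<le> t \<Longrightarrow> t \<le> 1 \<Longrightarrow>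
      ip d (G (x + t *\<^sub>R (y - x)) - G x) (y - x) \<le> c * t * (l2_norm d (y - x))\<^sup>2"
  shows "L y \<le> L x + ip d (G x) (y - x) + c / 2 * (l2_norm d (y - x))\<^sup>2"
proof -
  let ?n = "(l2_norm d (y - x))\<^sup>2"
  let ?h = "\<lambda>t. L (x + t *\<^sub>R (y - x)) - t * ip d (G x) (y - x) - c * t\<^sup>2 / 2 * ?n"
  have "?h 0 \<ge> ?h 1"
  proof (rule DERIV_nonpos_imp_nonincreasing [OF zero_le_one])
    fix t :: real assume t: "0 \<le> t" "t \<le> 1"
    have "(?h has_real_derivative
        ip d (G (x + t *\<^sub>R (y - x))) (y - x) - ip d (G x) (y - x) - c * t * ?n) (at t)"
      by (rule derivative_eq_intros DERIV_L_line refl | simp add: xy)+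
    moreover have "ip d (G (x + t *\<^sub>R (y - x))) (y - x) - ip d (G x) (y - x) - c * t * ?n \<le> 0"
      using grow [OF t] by (simp add: ip_diff_left)
    ultimately show "\<exists>D. (?h has_real_derivative D) (at t) \<and> D \<le> 0"
      by blast
  qed
  then show ?thesis by simp
qed

lemma quadratic_lower_bound:
  assumes xy: "x \<in> Rd d" "y \<in> Rd d"
    and grow: "\<And>t. 0 \<le> t \<Longrightarrow> t \<le> 1 \<Longrightarrow>
      c * t * (l2_norm d (y - x))\<^sup>2 \<le> ip d (G (x + t *\<^sub>R (y - x)) - G x) (y - x)"
  shows "L x + ip d (G x) (y - x) + c / 2 * (l2_norm d (y - x))\<^sup>2 \<le> L y"
proof -
  let ?n = "(l2_norm d (y - x))\<^sup>2"
  let ?h = "\<lambda>t. L (x + t *\<^sub>R (y - x)) - t * ip d (G x) (y - x) - c * t\<^sup>2 / 2 * ?n"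
  have "?h 0 \<le> ?h 1"
  proof (rule DERIV_nonneg_imp_nondecreasing [OF zero_le_one])
    fix t :: real assume t: "0 \<le> t" "t \<le> 1"
    have "(?h has_real_derivative
        ip d (G (x + t *\<^sub>R (y - x))) (y - x) - ip d (G x) (y - x) - c * t * ?n) (at t)"
      by (rule derivative_eq_intros DERIV_L_line refl | simp add: xy)+
    moreover have "ip d (G (x + t *\<^sub>R (y - x))) (y - x) - ip d (G x) (y - x) - c * t * ?n \<ge> 0"
      using grow [OF t] by (simp add: ip_diff_left)
    ultimately show "\<exists>D. (?h has_real_derivative D) (at t) \<and> D \<ge> 0"
      by blast
  qed
  then show ?thesis by simp
qed

lemma lipschitz_imp_quadratic_upper_bound:
  assumes xy: "x \<in> B2 d \<rho> c" "y \<in> B2 d \<rho> c"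
    and lip: "\<forall>b1\<in>B2 d \<rho> c. \<forall>b2\<in>B2 d \<rho> c. l2_norm d (G b1 - G b2) \<le> K * l2_norm d (b1 - b2)"
  shows "L y \<le> L x + ip d (G x) (y - x) + K / 2 * (l2_norm d (y - x))\<^sup>2"
proof (rule quadratic_upper_bound)
  fix t :: real assume t: "0 \<le> t" "t \<le> 1"
  let ?z = "x + t *\<^sub>R (y - x)"
  have "?z - c = (1 - t) *\<^sub>R (x - c) + t *\<^sub>R (y - c)"
    by (simp add: algebra_simps)
  then have "l2_norm d (?z - c) \<le> (1 - t) * l2_norm d (x - c) + t * l2_norm d (y - c)"
    using l2_norm_triangle [of d "(1 - t) *\<^sub>R (x - c)" "t *\<^sub>R (y - c)"] t by simp
  also have "\<dots> \<le> (1 - t) * \<rho> + t * \<rho>"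
    using xy t by (intro add_mono mult_left_mono) (auto simp: B2_def)
  finally have z: "?z \<in> B2 d \<rho> c"
    using xy by (simp add: B2_def algebra_simps)
  have "ip d (G ?z - G x) (y - x) \<le> l2_norm d (G ?z - G x) * l2_norm d (y - x)"
    using ip_le_l2_norm [of d "G ?z - G x" "y - x"] by simp
  also have "\<dots> \<le> (K * l2_norm d (?z - x)) * l2_norm d (y - x)"
    using bspec [OF bspec [OF lip z] xy(1)] by (intro mult_right_mono) auto
  finally show "ip d (G ?z - G x) (y - x) \<le> K * t * (l2_norm d (y - x))\<^sup>2"
    using t by (simp add: power2_eq_square mult.assoc)
qed (use xy in \<open>auto simp: B2_def\<close>)


section \<open>The Hessian as a positive semidefinite form\<close>

definition Hform :: "rvec \<Rightarrow> rvec \<Rightarrow> real" where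
  "Hform x v = ip d v (hess d L x v)"

lemma DERIV_gradient_line:
  assumes "G differentiable (at (x + t *\<^sub>R h) within Rd d)" "x \<in> Rd d" "h \<in> Rd d"
  shows "((\<lambda>\<tau>. ip d (G (x + \<tau> *\<^sub>R h)) h) has_real_derivative Hform (x + t *\<^sub>R h) h) (at t)"
proof -
  have H: "(G has_derivative hess d L (x + t *\<^sub>R h)) (at (x + t *\<^sub>R h) within Rd d)"
    using assms(1) by (simp add: hess_def frechet_derivative_works)
  have "((\<lambda>\<tau>. ip d (G (x + \<tau> *\<^sub>R h)) h) has_derivative
      (\<lambda>\<tau>. ip d (hess d L (x + t *\<^sub>R h) (\<tau> *\<^sub>R h)) h)) (at t)"
    by (intro bounded_linear.has_derivative [OF bounded_linear_ip_left]
        has_derivative_on_line [OF H] assms)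
  moreover have "hess d L (x + t *\<^sub>R h) (\<tau> *\<^sub>R h) = \<tau> *\<^sub>R hess d L (x + t *\<^sub>R h) h" for \<tau>
    using H by (simp add: has_derivative_linear linear_scale)
  ultimately show ?thesis
    by (simp add: has_field_derivative_def Hform_def ip_commute [of d h] mult_commute_abs)
qed

context
  fixes x :: rvec
  assumes x: "x \<in> Rd d" and twice: "G differentiable (at x within Rd d)"
begin

lemma hess_linear: "linear (hess d L x)"
  using twice by (metis frechet_derivative_works has_derivative_linear hess_def)

text \<open>Monotonicity of the gradient makes the Hessian form nonnegative.\<close>

lemma Hform_nonneg:
  assumes v: "v \<in> Rd d"
  shows "0 \<le> Hform x v"
proof (rule mono_on_imp_deriv_nonneg)
  show "mono_on UNIV (\<lambda>\<tau>. ip d (G (x + \<tau> *\<^sub>R v)) v)"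
  proof (rule mono_onI)
    fix a b :: real assume "a \<le> b"
    show "ip d (G (x + a *\<^sub>R v)) v \<le> ip d (G (x + b *\<^sub>R v)) v"
    proof (cases "a = b")
      case False
      have "(x + b *\<^sub>R v) - (x + a *\<^sub>R v) = (b - a) *\<^sub>R v"
        by (simp add: algebra_simps)
      then have "0 \<le> (b - a) * ip d (G (x + b *\<^sub>R v) - G (x + a *\<^sub>R v)) v"
        using gradient_monotone [of "x + a *\<^sub>R v" "x + b *\<^sub>R v"] x v
        by simp
      with False \<open>a \<le> b\<close> show ?thesis
        by (simp add: zero_le_mult_iff ip_diff_left)
    qed simp
  qed
  show "((\<lambda>\<tau>. ip d (G (x + \<tau> *\<^sub>R v)) v) has_real_derivative Hform x v) (at 0)"
    using DERIV_gradient_line [of x 0 v] x v twice by simp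
qed simp

lemma Hform_scaleR: "Hform x (a *\<^sub>R v) = a\<^sup>2 * Hform x v"
  by (simp add: Hform_def linear_scale [OF hess_linear] power2_eq_square)

lemma Hform_add:
  "Hform x (a *\<^sub>R u + b *\<^sub>R v) =
    a\<^sup>2 * Hform x u + a * b * (ip d u (hess d L x v) + ip d v (hess d L x u)) + b\<^sup>2 * Hform x v"
  by (simp add: Hform_def linear_add [OF hess_linear] linear_scale [OF hess_linear] ip_bilinear
      power2_eq_square algebra_simps)

text \<open>
  The square root of a nonnegative quadratic form is subadditive: this is Cauchy-Schwarz for
  the symmetrized bilinear form, which has the same quadratic form.
\<close>

lemma sqrt_Hform_triangle:
  assumes uv: "u \<in> Rd d" "v \<in> Rd d"
  shows "sqrt (Hform x (u + v)) \<le> sqrt (Hform x u) + sqrt (Hform x v)"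
proof -
  define p q B where "p = sqrt (Hform x u)" and "q = sqrt (Hform x v)"
    and "B = ip d u (hess d L x v) + ip d v (hess d L x u)"
  have pq: "0 \<le> p" "0 \<le> q" "p\<^sup>2 = Hform x u" "q\<^sup>2 = Hform x v"
    using uv by (simp_all add: p_def q_def Hform_nonneg)
  have form: "0 \<le> a\<^sup>2 * p\<^sup>2 + a * b * B + b\<^sup>2 * q\<^sup>2" for a b
    using Hform_nonneg [of "a *\<^sub>R u + b *\<^sub>R v"] uv by (simp add: Hform_add pq B_def)
  have "B \<le> 2 * p * q"
  proof (cases "p = 0 \<or> q = 0")
    case False
    then have "0 < p * q" using pq by simp
    moreover have "0 \<le> p * q * (2 * p * q - B)"
      using form [of q "-p"] by (simp add: power2_eq_square algebra_simps)
    ultimately have "0 \<le> 2 * p * q - B"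
      by (simp only: zero_le_mult_iff) linarith
    then show ?thesis by simp
  next
    case True
    \<comment> \<open>If one of the two forms vanishes, the cross term must not be positive, as it could
      be scaled up against the other form.\<close>
    show ?thesis
    proof (rule ccontr)
      assume "\<not> ?thesis"
      then have B: "0 < B" using True by auto
      from True show False
      proof
        assume "p = 0"
        with form [of "- (q\<^sup>2 + 1) / B" 1] B show False by simp
      next
        assume "q = 0"
        with form [of 1 "- (p\<^sup>2 + 1) / B"] B show False by simp
      qed
    qed
  qed
  then have "Hform x (u + v) \<le> (p + q)\<^sup>2"
    using Hform_add [of 1 u 1 v] by (simp add: pq B_def power2_sum algebra_simps)
  then have "sqrt (Hform x (u + v)) \<le> sqrt ((p + q)\<^sup>2)"
    by (rule real_sqrt_le_mono)
  then show ?thesis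
    using pq by (simp add: p_def q_def)
qed

end

end


section \<open>Strong convexity on the cone from sparse eigenvalues\<close>

lemma exists_largest_subset:
  fixes f :: "'a \<Rightarrow> real"
  assumes "finite A" "t \<le> card A"
  shows "\<exists>J\<subseteq>A. card J = t \<and> (\<forall>i\<in>J. \<forall>j\<in>A - J. f j \<le> f i)"
  using assms(2)
proof (induction t)
  case 0
  then show ?case by (intro exI [of _ "{}"]) auto
next
  case (Suc t)
  then obtain J where J: "J \<subseteq> A" "card J = t" "\<forall>i\<in>J. \<forall>j\<in>A - J. f j \<le> f i"
    by auto
  have fin: "finite (A - J)" "finite J"
    using assms J finite_subset by auto
  have "A - J \<noteq> {}"
    using J Suc.prems by auto
  then have "Max (f ` (A - J)) \<in> f ` (A - J)"
    using fin by (intro Max_in) auto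
  then obtain m where m: "m \<in> A - J" "f m = Max (f ` (A - J))"
    by auto
  then have "\<forall>j\<in>A - J. f j \<le> f m"
    using fin by auto
  with J m fin show ?case
    by (intro exI [of _ "insert m J"]) auto
qed

text \<open>
  Cut \<open>A\<close> into blocks of \<open>t\<close> coordinates, of decreasing size of the entries. Every entry of a
  block is at most the average of the entries of the preceding block, so the \<open>\<ell>\<^sub>2\<close> norm of a
  block is at most \<open>1 / sqrt t\<close> times the \<open>\<ell>\<^sub>1\<close> norm of the preceding one. Thus a subadditive
  functional that is controlled by the \<open>\<ell>\<^sub>2\<close> norm on \<open>t\<close>-sparse vectors is controlled by the
  \<open>\<ell>\<^sub>1\<close> norm on all blocks but the first.
\<close>

lemma shelling:
  fixes p :: "rvec \<Rightarrow> real"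
  assumes A: "A \<subseteq> {..<d}" and t: "0 < t"
    and p0: "p 0 = 0"
    and tri: "\<And>u v. u \<in> Rd d \<Longrightarrow> v \<in> Rd d \<Longrightarrow> p (u + v) \<le> p u + p v"
    and bound: "\<And>J. J \<subseteq> {..<d} \<Longrightarrow> card J \<le> t \<Longrightarrow> p (restr d J v) \<le> c * l2_norm d (restr d J v)"
    and c: "0 \<le> c"
  shows "\<exists>J\<subseteq>A. card J \<le> t \<and>
    p (restr d (A - J) v) \<le> c / sqrt (real t) * l1_norm d (restr d A v)"
  using A
proof (induction "card A" arbitrary: A rule: less_induct)
  case less
  have fin: "finite A"
    using less.prems finite_subset by blast
  show ?case
  proof (cases "card A \<le> t")
    case True
    then show ?thesis
      by (intro exI [of _ A]) (simp add: p0 c)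
  next
    case False
    then obtain J where J: "J \<subseteq> A" "card J = t"
      and large: "\<And>i j. i \<in> J \<Longrightarrow> j \<in> A - J \<Longrightarrow> \<bar>coord v j\<bar> \<le> \<bar>coord v i\<bar>"
      using exists_largest_subset [OF fin, of t "\<lambda>i. \<bar>coord v i\<bar>"] by auto
    have finJ: "finite J"
      using J fin finite_subset by blast
    have "card (A - J) < card A"
      using J t False fin finJ by (simp add: card_Diff_subset)
    then obtain J' where J': "J' \<subseteq> A - J" "card J' \<le> t"
      and IH: "p (restr d (A - J - J') v) \<le> c / sqrt (real t) * l1_norm d (restr d (A - J) v)"
      using less.hyps [of "A - J"] less.prems by blast
    have fin': "finite J'" and sub': "J' \<subseteq> {..<d}" and sub: "J \<subseteq> {..<d}"
      using J' J fin less.prems finite_subset by blast+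
    define m where "m = l1_norm d (restr d J v) / real t"
    have m: "0 \<le> m"
      by (simp add: m_def)
    have "\<bar>coord v j\<bar> \<le> m" if "j \<in> J'" for j
    proof -
      have "real t * \<bar>coord v j\<bar> = (\<Sum>i\<in>J. \<bar>coord v j\<bar>)"
        using J by simp
      also have "\<dots> \<le> l1_norm d (restr d J v)"
        unfolding l1_norm_restr_eq [OF sub] using that J' by (intro sum_mono large) auto
      finally show ?thesis
        using t by (simp add: m_def field_simps)
    qed
    then have "(\<Sum>j\<in>J'. (coord v j)\<^sup>2) \<le> (\<Sum>j\<in>J'. m\<^sup>2)"
      using m by (intro sum_mono) (simp add: abs_le_square_iff [symmetric])
    also have "\<dots> \<le> real t * m\<^sup>2"
      using J' by (simp add: mult_right_mono)
    finally have "l2_norm d (restr d J' v) \<le> sqrt (real t * m\<^sup>2)"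
      unfolding l2_norm_restr_eq [OF sub'] L2_set_def by (rule real_sqrt_le_mono)
    also have "\<dots> = l1_norm d (restr d J v) / sqrt (real t)"
    proof -
      have "l1_norm d (restr d J v) = real t * m"
        using t by (simp add: m_def)
      then have "l1_norm d (restr d J v) / sqrt (real t) = real t / sqrt (real t) * m"
        by simp
      then show ?thesis
        using m by (simp add: real_sqrt_mult real_div_sqrt)
    qed
    finally have block: "c * l2_norm d (restr d J' v) \<le> c / sqrt (real t) * l1_norm d (restr d J v)"
      using mult_left_mono [OF _ c] by fastforce
    have "restr d (A - J) v = restr d J' v + restr d (A - J - J') v"
      using restr_disjoint_union [of J' "A - J - J'" d v] J' by (simp add: Un_absorb1)
    then have "p (restr d (A - J) v) \<le> p (restr d J' v) + p (restr d (A - J - J') v)"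
      using tri by simp
    also have "\<dots> \<le> c / sqrt (real t) * l1_norm d (restr d J v) +
        c / sqrt (real t) * l1_norm d (restr d (A - J) v)"
      using bound [OF sub' J'(2)] block IH by linarith
    also have "\<dots> = c / sqrt (real t) * l1_norm d (restr d A v)"
      using l1_norm_restr_disjoint_union [of J "A - J" d v] J
      by (simp add: Un_absorb1 distrib_left)
    finally show ?thesis
      using J by (intro exI [of _ J]) auto
  qed
qed

context smooth_convex
begin

lemma LSE_sparse_eigenvalue_bounds:
  assumes lse: "LSE d L bstar lo up c C r"
  obtains t :: nat where "c * real (card (supp bstar)) \<le> real t"
    and "\<And>x J v. x \<in> B2 d r bstar \<Longrightarrow> G differentiable (at x within Rd d) \<Longrightarrow>
      J \<subseteq> {..<d} \<Longrightarrow> card J \<le> 2 * card (supp bstar) + 2 * t \<Longrightarrow>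
      lo * (l2_norm d (restr d J v))\<^sup>2 \<le> Hform x (restr d J v) \<and>
      Hform x (restr d J v) \<le> up * (l2_norm d (restr d J v))\<^sup>2"
proof -
  let ?m = "\<lambda>t. 2 * card (supp bstar) + 2 * t"
  from lse obtain t :: nat where t: "c * real (card (supp bstar)) \<le> real t"
    and lo: "ereal lo \<le> rho_minus d L bstar (?m t) r"
    and up: "rho_plus d L bstar (?m t) r \<le> ereal up"
    by (auto simp: LSE_def Let_def)
  show thesis
  proof
    show "c * real (card (supp bstar)) \<le> real t" by fact
    fix x J v
    assume x: "x \<in> B2 d r bstar" and tw: "G differentiable (at x within Rd d)"
      and J: "J \<subseteq> {..<d}" "card J \<le> ?m t"
    let ?w = "restr d J v" and ?n = "l2_norm d (restr d J v)"
    have xR: "x \<in> Rd d" using x by (simp add: B2_def)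
    show "lo * ?n\<^sup>2 \<le> Hform x ?w \<and> Hform x ?w \<le> up * ?n\<^sup>2"
    proof (cases "?n = 0")
      case True
      then have "?w = 0" by (simp add: l2_norm_eq_0_iff)
      then show ?thesis by (simp add: Hform_def)
    next
      case False
      then have n: "0 < ?n" by (simp add: less_le)
      let ?u = "(1 / ?n) *\<^sub>R v"
      have u: "restr d J ?u = (1 / ?n) *\<^sub>R ?w"
        by (rule Rd_eqI [of _ d]) auto
      have "l2_norm d (restr d J ?u) = 1"
        using n by (simp add: u)
      moreover have "restr d J ?u = restr d J (restr d J ?u)"
        by (rule Rd_eqI [of _ d]) auto
      ultimately have "Hform x (restr d J ?u) \<in> sparse_forms d L bstar (?m t) r"
        unfolding sparse_forms_def Hform_def using x J
        by (intro CollectI exI [of _ "restr d J ?u"] exI [of _ J] exI [of _ x]) auto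
      then have "ereal lo \<le> ereal (Hform x (restr d J ?u))"
        and "ereal (Hform x (restr d J ?u)) \<le> ereal up"
        using order_trans [OF lo [unfolded rho_minus_def] INF_lower]
          order_trans [OF SUP_upper up [unfolded rho_plus_def]] by blast+
      then show ?thesis
        using n by (simp add: u Hform_scaleR [OF xR tw] field_simps power_divide)
    qed
  qed
qed

text \<open>
  On the cone the part of \<open>v\<close> beyond \<open>S\<close> and the \<open>t\<close> largest remaining coordinates is small
  compared with the rest of \<open>v\<close> when \<open>t\<close> is a large multiple of \<open>s\<close>; both for the Euclidean
  norm and for the Hessian form. The shelling bound is applied to the sum of the two
  seminorms, scaled to be comparable, so that one set of coordinates serves both. The multiple
  \<open>144 up / lo\<close> makes the remainder half of the main part.
\<close>

lemma restricted_eigenvalue: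
  assumes x: "x \<in> Rd d" and tw: "G differentiable (at x within Rd d)"
    and S: "S \<subseteq> {..<d}" "S \<noteq> {}"
    and lo: "0 < lo" "lo \<le> up"
    and t: "144 * up / lo * real (card S) \<le> real t"
    and eig: "\<And>J v. J \<subseteq> {..<d} \<Longrightarrow> card J \<le> 2 * card S + 2 * t \<Longrightarrow>
      lo * (l2_norm d (restr d J v))\<^sup>2 \<le> Hform x (restr d J v) \<and>
      Hform x (restr d J v) \<le> up * (l2_norm d (restr d J v))\<^sup>2"
    and v: "v \<in> Rd d"
    and cone: "l1_norm d (restr d (-S) v) \<le> 3 * l1_norm d (restr d S v)"
  shows "lo / 9 * (l2_norm d v)\<^sup>2 \<le> Hform x v"
proof -
  let ?s = "card S" and ?A = "{..<d} - S"
  have fS: "finite S" using S finite_subset by blast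
  then have s: "0 < ?s" using S by (simp add: card_gt_0_iff)
  have up: "0 < up" using lo by simp
  have "0 < 144 * up / lo * real ?s" using up lo s by simp
  then have t0: "0 < t" using t by linarith
  define p where "p w = sqrt (Hform x w / up) + l2_norm d w" for w
  have "p (u + w) \<le> p u + p w" if "u \<in> Rd d" "w \<in> Rd d" for u w
  proof -
    have "sqrt (Hform x (u + w)) / sqrt up \<le> (sqrt (Hform x u) + sqrt (Hform x w)) / sqrt up"
      using sqrt_Hform_triangle [OF x tw that] up by (intro divide_right_mono) auto
    then show ?thesis
      using l2_norm_triangle [of d u w] by (simp add: p_def real_sqrt_divide add_divide_distrib)
  qed
  moreover have "p (restr d J v) \<le> 2 * l2_norm d (restr d J v)"
    if "J \<subseteq> {..<d}" "card J \<le> t" for J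
  proof -
    have "Hform x (restr d J v) / up \<le> (l2_norm d (restr d J v))\<^sup>2"
      using eig [of J v] that up by (simp add: field_simps)
    then have "sqrt (Hform x (restr d J v) / up) \<le> l2_norm d (restr d J v)"
      by (simp add: real_le_lsqrt real_le_lsqrt)
    then show ?thesis by (simp add: p_def)
  qed
  moreover have "p 0 = 0" by (simp add: p_def Hform_def)
  ultimately obtain J where J: "J \<subseteq> ?A" "card J \<le> t"
    and tail: "p (restr d (?A - J) v) \<le> 2 / sqrt (real t) * l1_norm d (restr d ?A v)"
    using shelling [of ?A d t p v 2] t0 by auto
  define a b where "a = restr d (S \<union> J) v" and "b = restr d (?A - J) v"
  have ab: "v = a + b" "a \<in> Rd d" "b \<in> Rd d"
  proof -
    have "restr d (S \<union> J \<union> (?A - J)) v = a + b"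
      unfolding a_def b_def by (rule restr_disjoint_union) auto
    moreover have "restr d (S \<union> J \<union> (?A - J)) v = v"
      by (rule restr_all [OF v]) auto
    ultimately show "v = a + b" by simp
  qed (simp_all add: a_def b_def)
  have "restr d ?A v = restr d (-S) v" by (rule Rd_eqI [of _ d]) auto
  then have "l1_norm d (restr d ?A v) \<le> 3 * (sqrt ?s * l2_norm d (restr d S v))"
    using cone l1_norm_restr_le_l2_norm [OF S(1), of v] by simp
  also have "\<dots> \<le> 3 * (sqrt ?s * l2_norm d a)"
    by (simp add: a_def l2_norm_restr_mono mult_left_mono)
  finally have "2 / sqrt (real t) * l1_norm d (restr d ?A v)
      \<le> 2 / sqrt (real t) * (3 * (sqrt ?s * l2_norm d a))"
    by (rule mult_left_mono) simp
  then have "p b \<le> 2 / sqrt (real t) * (3 * (sqrt ?s * l2_norm d a))"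
    using tail by (simp only: b_def)
  also have "\<dots> = 6 * sqrt (real ?s / real t) * l2_norm d a"
    by (simp add: real_sqrt_divide)
  also have "\<dots> \<le> 6 * (sqrt (lo / up) / 12) * l2_norm d a"
  proof -
    have "144 * (real ?s / real t) \<le> lo / up"
      using t t0 lo up by (simp add: field_simps)
    then have "12 * sqrt (real ?s / real t) \<le> sqrt (lo / up)"
      by (intro real_le_rsqrt) (simp add: power_mult_distrib)
    then show ?thesis
      by (intro mult_right_mono) auto
  qed
  finally have pb: "p b \<le> sqrt (lo / up) / 2 * l2_norm d a" by simp
  have Hb: "0 \<le> Hform x b"
    using Hform_nonneg [OF x tw] ab by auto
  have norm_b: "l2_norm d b \<le> l2_norm d a / 2"
  proof -
    have "sqrt (lo / up) \<le> 1" using lo by simp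
    then have "sqrt (lo / up) / 2 * l2_norm d a \<le> 1 / 2 * l2_norm d a"
      by (intro mult_right_mono) auto
    moreover have "l2_norm d b \<le> p b" using Hb up by (simp add: p_def)
    ultimately show ?thesis using pb by simp
  qed
  have form_b: "sqrt (Hform x b) \<le> sqrt lo / 2 * l2_norm d a"
  proof -
    have "sqrt (Hform x b) / sqrt up \<le> sqrt lo / sqrt up / 2 * l2_norm d a"
      using pb l2_norm_nonneg [of d b] unfolding p_def real_sqrt_divide by linarith
    then show ?thesis using up by (simp add: field_simps)
  qed
  have "card (S \<union> J) \<le> 2 * ?s + 2 * t"
    using card_Un_le [of S J] J by linarith
  then have "lo * (l2_norm d a)\<^sup>2 \<le> Hform x a"
    using eig [of "S \<union> J" v] J S by (auto simp: a_def)
  then have "sqrt (lo * (l2_norm d a)\<^sup>2) \<le> sqrt (Hform x a)"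
    by (rule real_sqrt_le_mono)
  then have form_a: "sqrt lo * l2_norm d a \<le> sqrt (Hform x a)"
    by (simp add: real_sqrt_mult)
  have "a = v + (-1) *\<^sub>R b" using ab by simp
  then have "sqrt (Hform x a) \<le> sqrt (Hform x v) + sqrt (Hform x b)"
    using sqrt_Hform_triangle [OF x tw v Rd_scaleR [OF ab(3), of "-1"]]
      Hform_scaleR [OF x tw, of "-1" b]
    by (simp del: scaleR_minus_left)
  then have "sqrt lo / 2 * l2_norm d a \<le> sqrt (Hform x v)"
    using form_a form_b by simp
  moreover have "l2_norm d v \<le> 3 / 2 * l2_norm d a"
    using norm_b l2_norm_triangle [of d a b] ab by simp
  then have "sqrt lo / 3 * l2_norm d v \<le> sqrt lo / 2 * l2_norm d a"
    using mult_left_mono [of "l2_norm d v" "3 / 2 * l2_norm d a" "sqrt lo / 3"] lo by simp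
  ultimately have "sqrt lo / 3 * l2_norm d v \<le> sqrt (Hform x v)"
    by simp
  then have "(sqrt lo / 3 * l2_norm d v)\<^sup>2 \<le> (sqrt (Hform x v))\<^sup>2"
    using lo by (intro power_mono) auto
  then show ?thesis
    using lo Hform_nonneg [OF x tw v] by (simp add: power_mult_distrib power_divide)
qed

lemma strongly_convex_in_direction:
  assumes b: "b \<in> Rd d" and v: "v \<in> Rd d" "l2_norm d v \<le> r"
    and tw: "\<And>x. x \<in> B2 d r b \<Longrightarrow> G differentiable (at x within Rd d)"
    and curv: "\<And>x. x \<in> B2 d r b \<Longrightarrow> k * (l2_norm d v)\<^sup>2 \<le> Hform x v"
  shows "L b + ip d (G b) v + k / 2 * (l2_norm d v)\<^sup>2 \<le> L (b + v)"
proof -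
  have "k * t * (l2_norm d v)\<^sup>2 \<le> ip d (G (b + t *\<^sub>R v) - G b) v" if t: "0 \<le> t" "t \<le> 1" for t
  proof -
    let ?h = "\<lambda>\<tau>. ip d (G (b + \<tau> *\<^sub>R v)) v - \<tau> * (k * (l2_norm d v)\<^sup>2)"
    have "?h 0 \<le> ?h t"
    proof (rule DERIV_nonneg_imp_nondecreasing [OF t(1)])
      fix \<tau> assume \<tau>: "0 \<le> \<tau>" "\<tau> \<le> t"
      have "\<tau> * l2_norm d v \<le> 1 * r"
        using \<tau> t v by (intro mult_mono) auto
      then have x: "b + \<tau> *\<^sub>R v \<in> B2 d r b"
        using b v \<tau> by (simp add: B2_def)
      have "(?h has_real_derivative Hform (b + \<tau> *\<^sub>R v) v - k * (l2_norm d v)\<^sup>2) (at \<tau>)"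
        by (rule derivative_eq_intros DERIV_gradient_line tw x b v refl | simp)+
      then show "\<exists>D. (?h has_real_derivative D) (at \<tau>) \<and> 0 \<le> D"
        using curv [OF x] by (intro exI conjI) auto
    qed
    then show ?thesis by (simp add: ip_diff_left algebra_simps)
  qed
  then show ?thesis
    using quadratic_lower_bound [of b "b + v" k] b v by simp
qed

end


section \<open>Minimizers of the penalized loss\<close>

lemma l1_norm_perturb_ge:
  assumes "supp b \<subseteq> S"
  shows "l1_norm d b + l1_norm d (restr d (-S) v) - l1_norm d (restr d S v) \<le> l1_norm d (b + v)"
  unfolding l1_norm_def sum.distrib [symmetric] sum_subtractf [symmetric]
proof (intro sum_mono)
  fix i assume "i \<in> {..<d}"
  moreover
  have "coord b i = 0" if "i \<notin> S"
    using assms that by (auto simp: in_keys_iff)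
  ultimately show "\<bar>coord b i\<bar> + \<bar>coord (restr d (-S) v) i\<bar> - \<bar>coord (restr d S v) i\<bar>
      \<le> \<bar>coord (b + v) i\<bar>"
    by (cases "i \<in> S") (auto simp: lookup_add)
qed

lemma l1_norm_split: "l1_norm d v = l1_norm d (restr d S v) + l1_norm d (restr d (-S) v)"
  unfolding l1_norm_def sum.distrib [symmetric] by (intro sum.cong) auto

lemma subdiff_l1_normI:
  assumes xi: "xi \<in> Rd d"
    and bound: "\<And>i. i < d \<Longrightarrow> \<bar>coord xi i\<bar> \<le> 1"
    and align: "\<And>i. i < d \<Longrightarrow> coord xi i * coord x i = \<bar>coord x i\<bar>"
  shows "xi \<in> subdiff d (l1_norm d) x"
proof -
  have "l1_norm d x + ip d xi (y - x) \<le> l1_norm d y" for y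
  proof -
    have "coord xi i * coord y i \<le> \<bar>coord y i\<bar>" if "i < d" for i
      using mult_right_mono [OF bound [OF that], of "\<bar>coord y i\<bar>"]
        abs_ge_self [of "coord xi i * coord y i"] by (simp add: abs_mult)
    then show ?thesis
      unfolding l1_norm_def ip_def sum.distrib [symmetric]
      by (intro sum_mono) (simp add: lookup_minus right_diff_distrib align)
  qed
  then show ?thesis by (simp add: subdiff_def xi)
qed

context smooth_convex
begin

lemma omega_le:
  assumes d: "0 < d" and xi: "xi \<in> subdiff d (l1_norm d) x"
    and a: "\<And>i. i < d \<Longrightarrow> \<bar>coord (G x) i + lam * coord xi i\<bar> \<le> a"
  shows "omega d L (const_vec d lam) x \<le> a"
proof -
  let ?f = "\<lambda>xi. linf_norm d (G x + hadamard d (const_vec d lam) xi)"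
  have "bdd_below (?f ` subdiff d (l1_norm d) x)"
    using linf_norm_nonneg [OF d] by (intro bdd_belowI [of _ 0]) auto
  then have "omega d L (const_vec d lam) x \<le> ?f xi"
    unfolding omega_def using xi by (rule cINF_lower)
  also have "\<dots> \<le> a"
    using a by (simp add: linf_norm_le_iff d lookup_add)
  finally show ?thesis .
qed

definition F :: "real \<Rightarrow> rvec \<Rightarrow> real" where
  "F lam x = L x + lam * l1_norm d x"

lemma F_segment:
  assumes "0 \<le> lam" "x \<in> Rd d" "y \<in> Rd d" "0 \<le> t" "t \<le> 1"
  shows "F lam (x + t *\<^sub>R (y - x)) \<le> L (x + t *\<^sub>R (y - x)) + lam * ((1 - t) * l1_norm d x + t * l1_norm d y)"
    and "F lam (x + t *\<^sub>R (y - x)) \<le> (1 - t) * F lam x + t * F lam y"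
proof -
  have z: "x + t *\<^sub>R (y - x) = (1 - t) *\<^sub>R x + t *\<^sub>R y"
    by (simp add: algebra_simps)
  have "l1_norm d ((1 - t) *\<^sub>R x + t *\<^sub>R y) \<le> (1 - t) * l1_norm d x + t * l1_norm d y"
    using l1_norm_triangle [of d "(1 - t) *\<^sub>R x" "t *\<^sub>R y"] assms by simp
  with \<open>0 \<le> lam\<close> show *: "F lam (x + t *\<^sub>R (y - x)) \<le>
      L (x + t *\<^sub>R (y - x)) + lam * ((1 - t) * l1_norm d x + t * l1_norm d y)"
    unfolding F_def z by (simp add: mult_left_mono)
  have "L ((1 - t) *\<^sub>R x + t *\<^sub>R y) \<le> (1 - t) * L x + t * L y"
    using convex_onD [OF convex_L] assms by simp
  with * show "F lam (x + t *\<^sub>R (y - x)) \<le> (1 - t) * F lam x + t * F lam y"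
    unfolding z by (simp add: F_def algebra_simps)
qed

text \<open>
  The basic inequality of the lasso: at a point no worse than the sparse target, the gain on
  the penalty outside \<open>S\<close> is paid for on \<open>S\<close>, as the linear term of the loss is dominated by
  a quarter of the penalty.
\<close>

lemma sublevel_basic_inequality:
  assumes b: "b \<in> Rd d" "supp b \<subseteq> S" and v: "v \<in> Rd d"
    and lam: "0 < lam" "4 * linf_norm d (G b) \<le> lam"
    and le: "F lam (b + v) \<le> F lam b"
  shows "L (b + v) - L b - ip d (G b) v + 3 / 4 * lam * l1_norm d (restr d (-S) v)
    \<le> 5 / 4 * lam * l1_norm d (restr d S v)"
proof -
  have "\<bar>ip d (G b) v\<bar> \<le> lam / 4 * l1_norm d v"
    using lam by (intro order_trans [OF ip_le_linf_l1 mult_right_mono]) auto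
  then have "- ip d (G b) v \<le>
      lam / 4 * l1_norm d (restr d S v) + lam / 4 * l1_norm d (restr d (-S) v)"
    unfolding l1_norm_split [of d v S] by (simp add: distrib_left)
  moreover have "L (b + v) - L b \<le> lam * l1_norm d b - lam * l1_norm d (b + v)"
    using le by (simp add: F_def)
  moreover have "lam * (l1_norm d b + l1_norm d (restr d (-S) v) - l1_norm d (restr d S v))
      \<le> lam * l1_norm d (b + v)"
    using l1_norm_perturb_ge [OF b(2)] lam by (intro mult_left_mono) auto
  ultimately show ?thesis by (simp add: algebra_simps)
qed

lemma sublevel_in_cone:
  assumes b: "b \<in> Rd d" "supp b \<subseteq> S" and v: "v \<in> Rd d"
    and lam: "0 < lam" "4 * linf_norm d (G b) \<le> lam"
    and le: "F lam (b + v) \<le> F lam b"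
  shows "l1_norm d (restr d (-S) v) \<le> 3 * l1_norm d (restr d S v)"
proof -
  have "lam * (3 / 4 * l1_norm d (restr d (-S) v)) \<le> lam * (5 / 4 * l1_norm d (restr d S v))"
    using sublevel_basic_inequality [OF assms] gradient_inequality [of b "b + v"] b v by simp
  then show ?thesis
    using lam l1_norm_nonneg [of d "restr d S v"] unfolding mult_le_cancel_left_pos [OF lam(1)]
    by linarith
qed

lemma sublevel_error_bound:
  assumes b: "b \<in> Rd d" and S: "S = supp b" "S \<noteq> {}" and v: "v \<in> Rd d" "l2_norm d v \<le> r"
    and lam: "0 < lam" "4 * linf_norm d (G b) \<le> lam"
    and tw: "\<And>x. x \<in> B2 d r b \<Longrightarrow> G differentiable (at x within Rd d)"
    and lo: "0 < lo" "lo \<le> up"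
    and lse: "LSE d L b lo up (144 * up / lo) C r"
    and le: "F lam (b + v) \<le> F lam b"
  shows "l2_norm d v \<le> 45 / 2 * lam * sqrt (card S) / lo"
proof -
  let ?n = "l2_norm d v"
  have S_sub: "S \<subseteq> {..<d}" using S b by (simp add: Rd_def)
  obtain t :: nat where t: "144 * up / lo * real (card S) \<le> real t"
    and eig: "\<And>x J v. x \<in> B2 d r b \<Longrightarrow> G differentiable (at x within Rd d) \<Longrightarrow>
      J \<subseteq> {..<d} \<Longrightarrow> card J \<le> 2 * card S + 2 * t \<Longrightarrow>
      lo * (l2_norm d (restr d J v))\<^sup>2 \<le> Hform x (restr d J v) \<and>
      Hform x (restr d J v) \<le> up * (l2_norm d (restr d J v))\<^sup>2"
    using LSE_sparse_eigenvalue_bounds [OF lse] unfolding S(1) by metis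
  have cone: "l1_norm d (restr d (-S) v) \<le> 3 * l1_norm d (restr d S v)"
    using sublevel_in_cone [OF b _ v(1) lam le] S by simp
  have "lo / 9 * ?n\<^sup>2 \<le> Hform x v" if "x \<in> B2 d r b" for x
    using restricted_eigenvalue [OF _ tw [OF that] S_sub S(2) lo t eig [OF that tw [OF that]] v(1) cone]
      that by (simp add: B2_def)
  then have "lo / 18 * ?n\<^sup>2 \<le> L (b + v) - L b - ip d (G b) v"
    using strongly_convex_in_direction [OF b v tw, of "lo / 9"] by simp
  also have "\<dots> \<le> 5 / 4 * lam * l1_norm d (restr d S v)"
    using sublevel_basic_inequality [OF b _ v(1) lam le, of S] S lam
    by (smt (verit) l1_norm_nonneg mult_nonneg_nonneg order_refl divide_nonneg_nonneg)
  also have "\<dots> \<le> 5 / 4 * lam * (sqrt (card S) * ?n)"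
  proof (intro mult_left_mono)
    have "l2_norm d (restr d S v) \<le> ?n"
      using l2_norm_restr_mono [of S UNIV d v] restr_all [OF v(1), of UNIV] by simp
    then show "l1_norm d (restr d S v) \<le> sqrt (card S) * ?n"
      using l1_norm_restr_le_l2_norm [OF S_sub, of v]
      by (meson mult_left_mono order_trans real_sqrt_ge_zero of_nat_0_le_iff)
  qed (use lam in auto)
  finally have main: "lo / 18 * ?n\<^sup>2 \<le> 5 / 4 * lam * (sqrt (card S) * ?n)" .
  show ?thesis
  proof (cases "?n = 0")
    case False
    then have "0 < ?n" by (simp add: less_le)
    with main have "lo / 18 * ?n \<le> 5 / 4 * lam * sqrt (card S)"
      by (simp add: power2_eq_square flip: mult.assoc)
    then show ?thesis using lo by (simp add: field_simps)
  qed (use lam lo in simp)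
qed

text \<open>
  A minimizer over the ball of radius \<open>r\<close> exists by compactness. It lies in the sublevel set
  of \<open>b\<close>, so by the error bound it stays away from the boundary of the ball, and convexity
  makes it a global minimizer.
\<close>

lemma exists_minimizer_near_target:
  assumes b: "b \<in> Rd d" and S: "S = supp b" "S \<noteq> {}"
    and lam: "0 < lam" "4 * linf_norm d (G b) \<le> lam"
    and tw: "\<And>x. x \<in> B2 d r b \<Longrightarrow> G differentiable (at x within Rd d)"
    and lo: "0 < lo" "lo \<le> up"
    and lse: "LSE d L b lo up (144 * up / lo) C r"
    and r: "45 / 2 * lam * sqrt (card S) / lo < r"
  obtains m where "m \<in> Rd d" "l2_norm d (m - b) \<le> 45 / 2 * lam * sqrt (card S) / lo"
    "\<And>x. x \<in> Rd d \<Longrightarrow> F lam m \<le> F lam x"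
proof -
  have r0: "0 \<le> r"
    using r lam lo by (smt (verit) divide_nonneg_pos mult_nonneg_nonneg real_sqrt_ge_zero of_nat_0_le_iff)
  have "continuous_on (B2 d r b) L"
    using differentiable_imp_continuous_on [OF differentiable_L]
    by (rule continuous_on_subset) (auto simp: B2_def)
  then have "continuous_on (B2 d r b) (F lam)"
    unfolding F_def by (intro continuous_intros)
  moreover have bB: "b \<in> B2 d r b"
    using b r0 by (simp add: B2_def)
  ultimately obtain m where m: "m \<in> B2 d r b" and min: "\<And>x. x \<in> B2 d r b \<Longrightarrow> F lam m \<le> F lam x"
    using continuous_attains_inf [OF compact_B2] by blast
  then have mR: "m \<in> Rd d" by (simp add: B2_def)
  have near: "l2_norm d (m - b) \<le> 45 / 2 * lam * sqrt (card S) / lo"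
    using m min [OF bB] by (intro sublevel_error_bound [OF b S _ _ lam tw lo lse])
      (auto simp: B2_def b)
  show thesis
  proof
    fix x assume x: "x \<in> Rd d"
    define t where "t = min 1 ((r - l2_norm d (m - b)) / (l2_norm d (x - m) + 1))"
    have den: "0 < l2_norm d (x - m) + 1"
      using l2_norm_nonneg [of d "x - m"] by linarith
    then have t: "0 < t" "t \<le> 1"
      using near r by (auto simp: t_def)
    have "t * l2_norm d (x - m) \<le> t * (l2_norm d (x - m) + 1)"
      using t by simp
    also have "\<dots> \<le> r - l2_norm d (m - b)"
      using den by (simp add: t_def flip: pos_le_divide_eq)
    finally have "l2_norm d (m + t *\<^sub>R (x - m) - b) \<le> r"
      using l2_norm_triangle [of d "m - b" "t *\<^sub>R (x - m)"] t
    by (simp add: add_diff_eq diff_add_eq)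
    then have "F lam m \<le> F lam (m + t *\<^sub>R (x - m))"
      using x mR by (intro min) (simp add: B2_def)
    also have "\<dots> \<le> (1 - t) * F lam m + t * F lam x"
      using F_segment(2) [of lam m x t] mR x t lam by simp
    finally have "t * F lam m \<le> t * F lam x"
      by (simp add: algebra_simps)
    then show "F lam m \<le> F lam x"
      using t by simp
  qed fact+
qed

lemma minimizer_variational_inequality:
  assumes m: "m \<in> Rd d" and min: "\<And>x. x \<in> Rd d \<Longrightarrow> F lam m \<le> F lam x"
    and lam: "0 \<le> lam" and x: "x \<in> Rd d"
  shows "lam * l1_norm d m \<le> lam * l1_norm d x + ip d (G m) (x - m)"
proof (rule ccontr)
  let ?c = "lam * (l1_norm d x - l1_norm d m)"
  let ?h = "\<lambda>t. L (m + t *\<^sub>R (x - m)) + t * ?c"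
  assume "\<not> ?thesis"
  then have neg: "ip d (G m) (x - m) + ?c < 0" by (simp add: algebra_simps)
  have "(?h has_real_derivative ip d (G (m + 0 *\<^sub>R (x - m))) (x - m) + ?c) (at 0)"
    by (rule derivative_eq_intros DERIV_L_line m x Rd_diff refl | simp)+
  then obtain \<epsilon> where e: "0 < \<epsilon>" "\<forall>t>0. t < \<epsilon> \<longrightarrow> ?h (0 + t) < ?h 0"
    using DERIV_neg_dec_right [of ?h _ 0] neg by auto
  define t where "t = min 1 (\<epsilon> / 2)"
  have t: "0 < t" "t \<le> 1" "t < \<epsilon>" using e by (auto simp: t_def)
  then have "?h t < L m" using e by simp
  moreover have "F lam m \<le> F lam (m + t *\<^sub>R (x - m))"
    using m x by (intro min) simp
  ultimately show False
    using F_segment(1) [OF lam m x, of t] t by (simp add: F_def algebra_simps)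
qed

lemma minimizer_gradient_le:
  assumes m: "m \<in> Rd d" and min: "\<And>x. x \<in> Rd d \<Longrightarrow> F lam m \<le> F lam x"
    and lam: "0 \<le> lam" and i: "i < d"
  shows "\<bar>coord (G m) i\<bar> \<le> lam"
proof -
  have "- lam \<le> a * coord (G m) i" if a: "\<bar>a\<bar> = 1" for a
  proof -
    have "l1_norm d (axis_vec i) = 1"
      using i by (simp add: l1_norm_def axis_vec_def lookup_single when_def if_distrib cong: if_cong)
    then have "l1_norm d (m + a *\<^sub>R axis_vec i) \<le> l1_norm d m + 1"
      using l1_norm_triangle [of d m "a *\<^sub>R axis_vec i"] a by simp
    then have "lam * l1_norm d (m + a *\<^sub>R axis_vec i) \<le> lam * (l1_norm d m + 1)"
      using lam by (rule mult_left_mono)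
    then show ?thesis
      using minimizer_variational_inequality [OF m min lam, of "m + a *\<^sub>R axis_vec i"] i m
      by (simp add: distrib_left)
  qed
  from this [of 1] this [of "-1"] show ?thesis by simp
qed

text \<open>
  At the origin every vector of \<open>[-1, 1]\<^sup>d\<close> is a subgradient of the \<open>\<ell>\<^sub>1\<close> norm, in particular
  the one that certifies the optimality of the minimizer.
\<close>

lemma omega_zero_le:
  assumes d: "0 < d" and m: "m \<in> Rd d" and min: "\<And>x. x \<in> Rd d \<Longrightarrow> F lam m \<le> F lam x"
    and lam: "0 < lam"
  shows "omega d L (const_vec d lam) 0 \<le> l2_norm d (G 0 - G m)"
proof (rule omega_le [OF d])
  let ?xi = "mk_vec d (\<lambda>i. - coord (G m) i / lam)"
  show "?xi \<in> subdiff d (l1_norm d) 0"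
    using minimizer_gradient_le [OF m min] lam by (intro subdiff_l1_normI) auto
  fix i assume "i < d"
  then show "\<bar>coord (G 0) i + lam * coord ?xi i\<bar> \<le> l2_norm d (G 0 - G m)"
    using coord_le_l2_norm [of i d "G 0 - G m"] lam by (simp add: lookup_minus)
qed

end


section \<open>One proximal gradient step\<close>

lemma soft_threshold_residual:
  fixes z a :: real
  assumes "0 \<le> a"
  defines "u \<equiv> sgn z * max (\<bar>z\<bar> - a) 0"
  shows "\<bar>z - u\<bar> \<le> a" and "(z - u) * u = a * \<bar>u\<bar>"
  using assms by (auto simp: u_def sgn_if max_def abs_if algebra_simps)

context smooth_convex
begin

abbreviation step :: "real \<Rightarrow> real \<Rightarrow> rvec \<Rightarrow> rvec" where
  "step lam phi b \<equiv> T_step d L (const_vec d lam) phi b"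

definition step_subgradient :: "real \<Rightarrow> real \<Rightarrow> rvec \<Rightarrow> rvec" where
  "step_subgradient lam phi b =
    mk_vec d (\<lambda>i. - (coord (G b) i + phi * (coord (step lam phi b) i - coord b i)) / lam)"

lemma step_Rd [simp]: "step lam phi b \<in> Rd d"
  by (simp add: T_step_def Let_def)

text \<open>The optimality condition of the model that the step minimizes.\<close>

lemma step_subgradient_in_subdiff:
  assumes lam: "0 < lam" and phi: "0 < phi"
  shows "step_subgradient lam phi b \<in> subdiff d (l1_norm d) (step lam phi b)"
proof (rule subdiff_l1_normI)
  fix i assume i: "i < d"
  define z u where "z = coord b i - coord (G b) i / phi" and "u = coord (step lam phi b) i"
  have "u = sgn z * max (\<bar>z\<bar> - lam / phi) 0"
    using i by (simp add: u_def z_def T_step_def Let_def lookup_minus)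
  then have soft: "\<bar>z - u\<bar> \<le> lam / phi" "(z - u) * u = lam / phi * \<bar>u\<bar>"
    using soft_threshold_residual [of "lam / phi" z] lam phi by auto
  have xi: "coord (step_subgradient lam phi b) i = phi / lam * (z - u)"
    using i lam phi by (simp add: step_subgradient_def z_def u_def field_simps)
  show "\<bar>coord (step_subgradient lam phi b) i\<bar> \<le> 1"
  proof -
    have "phi * \<bar>z - u\<bar> \<le> lam"
      using soft(1) phi by (simp add: pos_le_divide_eq mult.commute)
    then show ?thesis
      using lam phi by (simp add: xi abs_mult)
  qed
  have "coord (step_subgradient lam phi b) i * u = phi / lam * ((z - u) * u)"
    by (simp add: xi)
  also have "\<dots> = \<bar>u\<bar>"
    using soft(2) lam phi by simp
  finally show "coord (step_subgradient lam phi b) i * coord (step lam phi b) i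
      = \<bar>coord (step lam phi b) i\<bar>"
    by (simp add: u_def)
qed (simp add: step_subgradient_def)

lemma step_variational_inequality:
  assumes lam: "0 < lam" and phi: "0 < phi" and x: "x \<in> Rd d"
  shows "lam * l1_norm d (step lam phi b)
    \<le> lam * l1_norm d x + ip d (G b + phi *\<^sub>R (step lam phi b - b)) (x - step lam phi b)"
proof -
  let ?T = "step lam phi b"
  let ?xi = "step_subgradient lam phi b"
  have "l1_norm d ?T + ip d ?xi (x - ?T) \<le> l1_norm d x"
    using step_subgradient_in_subdiff [OF lam phi, of b] x by (auto simp: subdiff_def)
  then have "lam * (l1_norm d ?T + ip d ?xi (x - ?T)) \<le> lam * l1_norm d x"
    using lam by (simp add: mult_left_mono)
  moreover have "lam * ip d ?xi (x - ?T) = - ip d (G b + phi *\<^sub>R (?T - b)) (x - ?T)"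
    unfolding ip_def sum_distrib_left sum_negf [symmetric]
    using lam by (intro sum.cong)
      (auto simp: step_subgradient_def lookup_add lookup_minus field_simps)
  ultimately show ?thesis
    by (simp add: distrib_left)
qed

text \<open>
  The fundamental inequality of proximal gradient methods. It needs the quadratic model only
  at the new point, with a curvature \<open>c\<close> that may differ from the coefficient of the step:
  \<open>c = phi\<close> is what the line search tests, and a smaller \<open>c\<close> leaves a strict gain.
\<close>

lemma step_inequality:
  assumes lam: "0 < lam" and phi: "0 < phi" and b: "b \<in> Rd d" and x: "x \<in> Rd d"
    and model: "L (step lam phi b) \<le> L b + ip d (G b) (step lam phi b - b)
      + c / 2 * (l2_norm d (step lam phi b - b))\<^sup>2"
  shows "F lam (step lam phi b) + phi / 2 * (l2_norm d (step lam phi b - x))\<^sup>2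
      + (phi - c) / 2 * (l2_norm d (step lam phi b - b))\<^sup>2
    \<le> F lam x + phi / 2 * (l2_norm d (b - x))\<^sup>2"
proof -
  let ?T = "step lam phi b"
  have "L b + ip d (G b) (x - b) \<le> L x"
    using gradient_inequality b x by simp
  with step_variational_inequality [OF lam phi x, of b] model
  have "F lam ?T \<le> F lam x + phi * ip d (?T - b) (x - ?T) + c / 2 * (l2_norm d (?T - b))\<^sup>2"
    by (simp add: F_def ip_bilinear right_diff_distrib)
  moreover have "2 * ip d (?T - b) (x - ?T)
      = (l2_norm d (b - x))\<^sup>2 - (l2_norm d (?T - x))\<^sup>2 - (l2_norm d (?T - b))\<^sup>2"
    by (simp add: l2_norm_square ip_bilinear ip_commute [of d b ?T] ip_commute [of d x b]
        ip_commute [of d x ?T] algebra_simps)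
  then have "phi * ip d (?T - b) (x - ?T) = phi / 2 *
      ((l2_norm d (b - x))\<^sup>2 - (l2_norm d (?T - x))\<^sup>2 - (l2_norm d (?T - b))\<^sup>2)"
    by simp
  ultimately show ?thesis
    by (simp add: algebra_simps diff_divide_distrib)
qed

lemma majorizes_iff:
  "majorizes d L (const_vec d lam) b phi \<longleftrightarrow>
    L (step lam phi b) \<le> L b + ip d (G b) (step lam phi b - b)
      + phi / 2 * (l2_norm d (step lam phi b - b))\<^sup>2"
  by (simp add: majorizes_def obj_def Psi_def)

text \<open>
  Comparing the optimality conditions of the step and of the minimizer bounds the distance of
  the new point before anything is known about the model there. This breaks the circle that
  the Lipschitz condition is available on a ball only.
\<close>

lemma step_dist_le:
  assumes lam: "0 < lam" and phi: "0 < phi" and b: "b \<in> Rd d"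
    and m: "m \<in> Rd d" and min: "\<And>x. x \<in> Rd d \<Longrightarrow> F lam m \<le> F lam x"
    and lip: "l2_norm d (G b - G m) \<le> phi * l2_norm d (b - m)"
  shows "l2_norm d (step lam phi b - m) \<le> 2 * l2_norm d (b - m)"
proof -
  let ?T = "step lam phi b"
  have "0 \<le> ip d (G b + phi *\<^sub>R (?T - b)) (m - ?T) + ip d (G m) (?T - m)"
    using step_variational_inequality [OF lam phi m, of b]
      minimizer_variational_inequality [OF m min, of ?T] lam by simp
  then have "phi * (l2_norm d (?T - m))\<^sup>2 \<le> phi * ip d (b - m) (?T - m) + ip d (G m - G b) (?T - m)"
    by (simp add: l2_norm_square ip_bilinear algebra_simps)
  also have "\<dots> \<le> phi * (l2_norm d (b - m) * l2_norm d (?T - m)) +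
      (phi * l2_norm d (b - m)) * l2_norm d (?T - m)"
  proof (rule add_mono)
    have "ip d (b - m) (?T - m) \<le> l2_norm d (b - m) * l2_norm d (?T - m)"
      using ip_le_l2_norm abs_le_D1 by blast
    then show "phi * ip d (b - m) (?T - m) \<le> phi * (l2_norm d (b - m) * l2_norm d (?T - m))"
      using phi by simp
    have "ip d (G m - G b) (?T - m) \<le> l2_norm d (G m - G b) * l2_norm d (?T - m)"
      using ip_le_l2_norm abs_le_D1 by blast
    also have "\<dots> \<le> (phi * l2_norm d (b - m)) * l2_norm d (?T - m)"
      using lip l2_norm_minus_commute [of d "G b" "G m"] by (intro mult_right_mono) auto
    finally show "ip d (G m - G b) (?T - m) \<le> (phi * l2_norm d (b - m)) * l2_norm d (?T - m)" .
  qed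
  finally have main: "phi * (l2_norm d (?T - m) * l2_norm d (?T - m))
      \<le> phi * (2 * l2_norm d (b - m) * l2_norm d (?T - m))"
    by (simp add: power2_eq_square)
  show ?thesis
  proof (cases "l2_norm d (?T - m) = 0")
    case False
    then have "0 < l2_norm d (?T - m)" by (simp add: less_le)
    with main phi show ?thesis by simp
  qed simp
qed

lemma omega_step_le:
  assumes d: "0 < d" and lam: "0 < lam" and phi: "0 < phi"
    and lip: "l2_norm d (G (step lam phi b) - G b) \<le> \<rho> * l2_norm d (step lam phi b - b)"
  shows "omega d L (const_vec d lam) (step lam phi b) \<le> (\<rho> + phi) * l2_norm d (step lam phi b - b)"
proof (rule omega_le [OF d step_subgradient_in_subdiff [OF lam phi]])
  let ?T = "step lam phi b"
  fix i assume i: "i < d"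
  have "coord (G ?T) i + lam * coord (step_subgradient lam phi b) i
      = coord (G ?T - G b) i - phi * coord (?T - b) i"
    using i lam by (simp add: step_subgradient_def lookup_minus)
  also have "\<bar>\<dots>\<bar> \<le> \<bar>coord (G ?T - G b) i\<bar> + phi * \<bar>coord (?T - b) i\<bar>"
    using phi abs_triangle_ineq4 [of "coord (G ?T - G b) i" "phi * coord (?T - b) i"]
    by (simp add: abs_mult)
  also have "\<dots> \<le> \<rho> * l2_norm d (?T - b) + phi * l2_norm d (?T - b)"
    using phi lip coord_le_l2_norm [OF i] by (intro add_mono mult_left_mono) (auto intro: order_trans)
  finally show "\<bar>coord (G ?T) i + lam * coord (step_subgradient lam phi b) i\<bar>
      \<le> (\<rho> + phi) * l2_norm d (?T - b)"
    by (simp add: distrib_right)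
qed

end


section \<open>The rate of the iteration\<close>

text \<open>
  \<open>Q\<close> is the radius of the ball on which the gradient is Lipschitz. It leaves room for trial
  steps, which may be twice as far from the minimizer \<open>m\<close> as the starting point.
\<close>

locale lamm_setting = smooth_convex +
  fixes bstar m :: rvec and Q lam \<rho> gamma phi0 :: real
  assumes d: "0 < d" and lam: "0 < lam" and gamma: "1 < gamma"
    and phi0: "0 < phi0" "phi0 \<le> \<rho>"
    and m: "m \<in> Rd d" and min: "\<And>x. x \<in> Rd d \<Longrightarrow> F lam m \<le> F lam x"
    and near: "\<And>x. x \<in> Rd d \<Longrightarrow> l2_norm d (x - m) \<le> 2 * l2_norm d m \<Longrightarrow> x \<in> B2 d Q bstar"
    and lip: "\<forall>b1\<in>B2 d Q bstar. \<forall>b2\<in>B2 d Q bstar.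
      l2_norm d (G b1 - G b2) \<le> \<rho> * l2_norm d (b1 - b2)"
begin

lemma rho_pos: "0 < \<rho>"
  using phi0 by simp

abbreviation "sqdist x \<equiv> (l2_norm d (x - m))\<^sup>2"
abbreviation "gap x \<equiv> F lam x - F lam m"
abbreviation "resid x \<equiv> omega d L (const_vec d lam) x"

definition in_range :: "rvec \<Rightarrow> real \<Rightarrow> bool" where
  "in_range x phi \<longleftrightarrow> x \<in> Rd d \<and> l2_norm d (x - m) \<le> l2_norm d m \<and> phi0 \<le> phi \<and> phi \<le> gamma * \<rho>"

lemma near_minimizer [simp]:
  assumes "x \<in> Rd d" "l2_norm d (x - m) \<le> l2_norm d m"
  shows "x \<in> B2 d Q bstar" "m \<in> B2 d Q bstar"
  using near [of x] near [of m] m assms l2_norm_nonneg [of d m] by auto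

lemma majorizes_large:
  assumes x: "x \<in> Rd d" "l2_norm d (x - m) \<le> l2_norm d m" and phi: "\<rho> \<le> phi"
  shows "majorizes d L (const_vec d lam) x phi"
proof -
  have phi_pos: "0 < phi" using phi rho_pos by simp
  have "l2_norm d (G x - G m) \<le> \<rho> * l2_norm d (x - m)"
    using lip x by simp
  also have "\<dots> \<le> phi * l2_norm d (x - m)"
    using phi by (simp add: mult_right_mono)
  finally have "l2_norm d (step lam phi x - m) \<le> 2 * l2_norm d (x - m)"
    by (intro step_dist_le [OF lam phi_pos x(1) m] min)
  then have "step lam phi x \<in> B2 d Q bstar"
    using x by (intro near) auto
  then have "L (step lam phi x) \<le> L x + ip d (G x) (step lam phi x - x)
      + \<rho> / 2 * (l2_norm d (step lam phi x - x))\<^sup>2"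
    using lip x by (intro lipschitz_imp_quadratic_upper_bound) auto
  also have "\<dots> \<le> L x + ip d (G x) (step lam phi x - x)
      + phi / 2 * (l2_norm d (step lam phi x - x))\<^sup>2"
    using phi by (simp add: mult_right_mono)
  finally show ?thesis
    by (simp add: majorizes_iff)
qed

text \<open>
  The coefficient never exceeds \<open>gamma * \<rho>\<close>, as the last rejected value is below \<open>\<rho>\<close>, and it
  drops at most by the factor \<open>gamma\<close> per iteration.
\<close>

lemma inner_search_terminates:
  assumes run: "lamm d L (const_vec d lam) gamma phi0 k x phi" and inr: "in_range x phi"
  obtains phi' where "lamm d L (const_vec d lam) gamma phi0 (Suc k) (step lam phi' x) phi'"
    "majorizes d L (const_vec d lam) x phi'" "phi0 \<le> phi'" "phi' \<le> gamma * \<rho>" "phi \<le> gamma * phi'"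
proof -
  define start where "start = max phi0 (phi / gamma)"
  let ?maj = "\<lambda>j. majorizes d L (const_vec d lam) x (start * gamma ^ j)"
  have start: "0 < start" "phi0 \<le> start" "phi / gamma \<le> start" "start \<le> \<rho>"
    using phi0 inr gamma by (auto simp: start_def in_range_def field_simps)
  obtain n where "\<rho> / start < gamma ^ n"
    using real_arch_pow [OF gamma] by blast
  then have "\<rho> \<le> start * gamma ^ n"
    using start by (simp add: field_simps)
  then have ex: "?maj n"
    using inr by (intro majorizes_large) (auto simp: in_range_def)
  define j where "j = (LEAST j. ?maj j)"
  have j: "?maj j" "\<forall>i<j. \<not> ?maj i"
    using LeastI [of ?maj, OF ex] not_less_Least [of _ ?maj] by (auto simp: j_def)
  have ge: "start \<le> start * gamma ^ j"
    using start gamma by (simp add: one_le_power)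
  have "start * gamma ^ j \<le> gamma * \<rho>"
  proof (cases j)
    case 0
    then show ?thesis
      using start gamma rho_pos mult_mono [of 1 gamma start \<rho>] by simp
  next
    case (Suc i)
    have "start * gamma ^ i < \<rho>"
      using j(2) Suc majorizes_large inr by (force simp: in_range_def not_le [symmetric])
    then show ?thesis
      using gamma by (simp add: Suc mult.left_commute)
  qed
  moreover have "phi \<le> gamma * (start * gamma ^ j)"
    using ge start(3) gamma mult_left_mono [of "phi / gamma" "start * gamma ^ j" gamma] by simp
  ultimately show thesis
    using lamm.step [OF run start_def j(2) j(1)] that j(1) ge start(2) by auto
qed

text \<open>
  Here \<open>\<omega>\<close> is the residual after a step of length \<open>\<delta>\<close> with coefficient \<open>\<phi>\<close>, and \<open>D\<close>, \<open>D'\<close> are the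
  squared distances to \<open>m\<close> before and after it. For \<open>\<phi> \<le> 2 * \<rho>\<close> the residual is at most
  \<open>3 * \<rho> * \<delta>\<close>. A larger coefficient exceeds the curvature \<open>\<rho>\<close> by so much that the step decreases
  the squared distance by a fixed share of \<open>\<delta>\<^sup>2\<close>. Charging the factor \<open>(1 + gamma)\<^sup>2\<close> to that
  decrease alone keeps it from being multiplied with the sum of the \<open>\<delta>\<^sup>2\<close>, which itself grows
  with \<open>gamma\<close>.
\<close>

lemma omega_square_estimate_arith:
  fixes \<omega> \<delta> \<phi> D D' :: real
  assumes om: "0 \<le> \<omega>" "\<omega> \<le> (\<rho> + \<phi>) * \<delta>" and \<phi>: "0 < \<phi>" "\<phi> \<le> gamma * \<rho>"
    and dec: "D' \<le> D" and gain: "2 * \<rho> < \<phi> \<Longrightarrow> \<delta>\<^sup>2 \<le> 2 * (D - D')"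
  shows "\<omega>\<^sup>2 \<le> 9 * \<rho>\<^sup>2 * \<delta>\<^sup>2 + 2 * (1 + gamma)\<^sup>2 * \<rho>\<^sup>2 * (D - D')"
proof -
  have sq: "\<omega>\<^sup>2 \<le> (\<rho> + \<phi>)\<^sup>2 * \<delta>\<^sup>2"
    using power_mono [OF om(2,1), of 2] by (simp add: power_mult_distrib)
  show ?thesis
  proof (cases "2 * \<rho> < \<phi>")
    case True
    have "(\<rho> + \<phi>)\<^sup>2 \<le> ((1 + gamma) * \<rho>)\<^sup>2"
      using \<phi> rho_pos by (intro power_mono) (auto simp: algebra_simps)
    then have "(\<rho> + \<phi>)\<^sup>2 * \<delta>\<^sup>2 \<le> ((1 + gamma) * \<rho>)\<^sup>2 * (2 * (D - D'))"
      using gain [OF True] by (intro mult_mono) auto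
    also have "\<dots> = 2 * (1 + gamma)\<^sup>2 * \<rho>\<^sup>2 * (D - D')"
      by (simp add: power_mult_distrib)
    moreover have "0 \<le> 9 * \<rho>\<^sup>2 * \<delta>\<^sup>2" by simp
    ultimately show ?thesis
      using sq by linarith
  next
    case False
    have "(\<rho> + \<phi>)\<^sup>2 \<le> (3 * \<rho>)\<^sup>2"
      using \<phi> False rho_pos by (intro power_mono) auto
    then have "(\<rho> + \<phi>)\<^sup>2 * \<delta>\<^sup>2 \<le> 9 * \<rho>\<^sup>2 * \<delta>\<^sup>2"
      by (intro mult_right_mono) (simp_all add: power_mult_distrib)
    moreover have "0 \<le> 2 * (1 + gamma)\<^sup>2 * \<rho>\<^sup>2 * (D - D')"
      using dec by simp
    ultimately show ?thesis
      using sq by linarith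
  qed
qed

lemma accepted_step:
  assumes inr: "in_range x phi" and phi': "phi0 \<le> phi'" "phi' \<le> gamma * \<rho>"
    and maj: "majorizes d L (const_vec d lam) x phi'"
  defines "x' \<equiv> step lam phi' x"
  shows "in_range x' phi'"
    and "2 * gap x' / phi' \<le> sqdist x - sqdist x'"
    and "(l2_norm d (x' - x))\<^sup>2 \<le> 2 * (gap x - gap x') / phi'"
    and "(resid x')\<^sup>2 \<le> 9 * \<rho>\<^sup>2 * (l2_norm d (x' - x))\<^sup>2
      + 2 * (1 + gamma)\<^sup>2 * \<rho>\<^sup>2 * (sqdist x - sqdist x')"
    and "resid x' \<le> (\<rho> + phi') * l2_norm d (x' - x)"
proof -
  let ?\<delta> = "l2_norm d (x' - x)"
  have x: "x \<in> Rd d" "l2_norm d (x - m) \<le> l2_norm d m"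
    using inr by (auto simp: in_range_def)
  have p: "0 < phi'" using phi' phi0 by simp
  have x': "x' \<in> Rd d" by (simp add: x'_def)
  have ineq: "F lam x' + phi' / 2 * (l2_norm d (x' - y))\<^sup>2 + (phi' - c) / 2 * ?\<delta>\<^sup>2
      \<le> F lam y + phi' / 2 * (l2_norm d (x - y))\<^sup>2"
    if "y \<in> Rd d" "L x' \<le> L x + ip d (G x) (x' - x) + c / 2 * ?\<delta>\<^sup>2" for y c
    using step_inequality [OF lam p x(1), of y c] that by (simp add: x'_def)
  have model: "L x' \<le> L x + ip d (G x) (x' - x) + phi' / 2 * ?\<delta>\<^sup>2"
    using maj by (simp add: majorizes_iff x'_def)
  have "2 * gap x' \<le> phi' * (sqdist x - sqdist x')"
    using ineq [OF m model] by (simp add: algebra_simps)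
  then show gain: "2 * gap x' / phi' \<le> sqdist x - sqdist x'"
    using p by (simp add: pos_divide_le_eq mult.commute)
  have "0 \<le> 2 * gap x' / phi'"
    using min [OF x'] p by simp
  then have dec: "sqdist x' \<le> sqdist x" using gain by linarith
  then have "l2_norm d (x' - m) \<le> l2_norm d (x - m)"
    by (rule power2_le_imp_le) simp
  with x x' phi' show inr': "in_range x' phi'"
    by (simp add: in_range_def)
  then have ball: "x \<in> B2 d Q bstar" "x' \<in> B2 d Q bstar"
    using x by (auto simp: in_range_def)
  have "phi' * ?\<delta>\<^sup>2 \<le> 2 * (gap x - gap x')"
    using ineq [OF x(1) model] by simp
  then show "?\<delta>\<^sup>2 \<le> 2 * (gap x - gap x') / phi'"
    using p by (simp add: pos_le_divide_eq mult.commute)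
  show om: "resid x' \<le> (\<rho> + phi') * ?\<delta>"
    unfolding x'_def using lip ball by (intro omega_step_le d lam p) (simp add: x'_def)
  have om0: "0 \<le> resid x'"
    unfolding omega_def using step_subgradient_in_subdiff [OF lam p, of x] linf_norm_nonneg [OF d]
    by (intro cINF_greatest) (auto simp: x'_def)
  show "(resid x')\<^sup>2 \<le> 9 * \<rho>\<^sup>2 * ?\<delta>\<^sup>2 + 2 * (1 + gamma)\<^sup>2 * \<rho>\<^sup>2 * (sqdist x - sqdist x')"
  proof (rule omega_square_estimate_arith [OF om0 om p phi'(2) dec])
    assume large: "2 * \<rho> < phi'"
    have "L x' \<le> L x + ip d (G x) (x' - x) + \<rho> / 2 * ?\<delta>\<^sup>2"
      using ball lip by (rule lipschitz_imp_quadratic_upper_bound)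
    from ineq [OF m this] min [OF x']
    have "(phi' - \<rho>) / 2 * ?\<delta>\<^sup>2 \<le> phi' / 2 * (sqdist x - sqdist x')"
      unfolding right_diff_distrib by linarith
    moreover have "phi' / 2 / 2 * ?\<delta>\<^sup>2 \<le> (phi' - \<rho>) / 2 * ?\<delta>\<^sup>2"
      using large by (intro mult_right_mono) auto
    ultimately have "phi' * ?\<delta>\<^sup>2 \<le> phi' * (2 * (sqdist x - sqdist x'))"
      by linarith
    then show "?\<delta>\<^sup>2 \<le> 2 * (sqdist x - sqdist x')"
      using p by simp
  qed
qed

text \<open>
  Squared increments are bounded by differences \<open>2 * (gap x - gap x') / phi'\<close>, which fail to
  telescope since the coefficient varies; but as \<open>1 / phi\<close> grows at most by the factor \<open>gamma\<close>
  per iteration, the excess is a multiple of \<open>gap x' / phi'\<close>, paid for by the decrease of the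
  squared distance. The outer weights are those of the estimate of the squared residual by the
  squared increment and the decrease of the squared distance.
\<close>

definition potential :: "rvec \<Rightarrow> real \<Rightarrow> real" where
  "potential x phi = 9 * \<rho>\<^sup>2 * ((gamma - 1) * sqdist x + 2 * gamma * (gap x / phi))
    + 2 * (1 + gamma)\<^sup>2 * \<rho>\<^sup>2 * sqdist x"

lemma potential_nonneg: "in_range x phi \<Longrightarrow> 0 \<le> potential x phi"
  unfolding potential_def in_range_def using gamma phi0 min [of x]
  by (intro add_nonneg_nonneg mult_nonneg_nonneg) auto

lemma potential_decrease:
  assumes inr: "in_range x phi" and phi': "phi0 \<le> phi'" "phi' \<le> gamma * \<rho>" "phi \<le> gamma * phi'"
    and maj: "majorizes d L (const_vec d lam) x phi'"
  defines "x' \<equiv> step lam phi' x"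
  shows "(resid x')\<^sup>2 + potential x' phi' \<le> potential x phi"
proof -
  note step = accepted_step [OF inr phi'(1,2) maj, folded x'_def]
  have x: "x \<in> Rd d" and p: "0 < phi" "0 < phi'"
    using inr phi0 phi' by (auto simp: in_range_def)
  define a a' where "a = gap x / phi" and "a' = gap x' / phi'"
  have "gap x / phi' \<le> gamma * a"
    using min [OF x] p phi'(3) mult_left_mono [OF phi'(3), of "gap x"] by (simp add: a_def field_simps)
  then have "(l2_norm d (x' - x))\<^sup>2 \<le> 2 * (gamma * a) - 2 * a'"
    using step(3) by (simp add: a'_def diff_divide_distrib)
  moreover have "(gamma - 1) * (2 * a') \<le> (gamma - 1) * (sqdist x - sqdist x')"
    using step(2) gamma by (intro mult_left_mono) (auto simp: a'_def)
  ultimately have "(l2_norm d (x' - x))\<^sup>2 + ((gamma - 1) * sqdist x' + 2 * gamma * a')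
      \<le> (gamma - 1) * sqdist x + 2 * gamma * a"
    by (simp add: algebra_simps)
  then have "9 * \<rho>\<^sup>2 * ((l2_norm d (x' - x))\<^sup>2 + ((gamma - 1) * sqdist x' + 2 * gamma * a'))
      \<le> 9 * \<rho>\<^sup>2 * ((gamma - 1) * sqdist x + 2 * gamma * a)"
    by (rule mult_left_mono) simp
  moreover have "w + (A * X' + C * D') \<le> A * X + C * D"
    if "w \<le> A * \<Delta> + C * (D - D')" "A * (\<Delta> + X') \<le> A * X" for w A X X' C D D' \<Delta> :: real
    using that by (simp add: algebra_simps)
  ultimately show ?thesis
    using step(4) unfolding potential_def a_def [symmetric] a'_def [symmetric] by blast
qed

text \<open>
  The first iteration is treated on its own, since the initial coefficient may be far too
  small and the initial potential correspondingly large.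
\<close>

lemma potential_first:
  assumes phi': "phi0 \<le> phi'" "phi' \<le> gamma * \<rho>"
    and maj: "majorizes d L (const_vec d lam) 0 phi'"
  defines "x' \<equiv> step lam phi' 0"
  shows "(resid x')\<^sup>2 + potential x' phi' \<le> 9 * (1 + gamma)\<^sup>2 * \<rho>\<^sup>2 * (l2_norm d m)\<^sup>2"
proof -
  let ?D = "(l2_norm d m)\<^sup>2" and ?C = "(1 + gamma)\<^sup>2 * \<rho>\<^sup>2"
  have norm0: "l2_norm d (0 - m) = l2_norm d m"
    using l2_norm_minus_commute [of d 0 m] by simp
  have "phi0 \<le> gamma * \<rho>"
    using phi' by simp
  then have inr: "in_range 0 phi0"
    by (simp add: in_range_def norm0 [simplified])
  note step = accepted_step [OF inr phi' maj, folded x'_def]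
  have inr': "l2_norm d (x' - m) \<le> l2_norm d m" and x': "x' \<in> Rd d" and p: "0 < phi'"
    using step(1) phi' phi0 by (auto simp: in_range_def)
  have "l2_norm d (x' - 0) \<le> 2 * l2_norm d m"
    using l2_norm_triangle [of d "x' - m" m] inr' by simp
  then have "(\<rho> + phi') * l2_norm d (x' - 0) \<le> ((1 + gamma) * \<rho>) * (2 * l2_norm d m)"
    using phi' p rho_pos gamma by (intro mult_mono) (auto simp: algebra_simps)
  with step(5) have "resid x' \<le> ((1 + gamma) * \<rho>) * (2 * l2_norm d m)" by simp
  moreover have "0 \<le> resid x'"
    unfolding omega_def using step_subgradient_in_subdiff [OF lam p, of 0] linf_norm_nonneg [OF d]
    by (intro cINF_greatest) (auto simp: x'_def)
  ultimately have "(resid x')\<^sup>2 \<le> (((1 + gamma) * \<rho>) * (2 * l2_norm d m))\<^sup>2"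
    by (rule power_mono)
  also have "\<dots> = 4 * (?C * ?D)"
    by (simp only: power_mult_distrib) simp
  finally have om: "(resid x')\<^sup>2 \<le> 4 * (?C * ?D)" .
  have D': "sqdist x' \<le> ?D"
    using inr' by (simp add: power_mono)
  define q where "q = gap x' / phi'"
  have "gamma * (2 * q) \<le> gamma * (?D - sqdist x')"
    using step(2) gamma unfolding norm0 by (intro mult_left_mono) (auto simp: q_def)
  then have "(gamma - 1) * sqdist x' + 2 * gamma * q \<le> gamma * ?D"
    unfolding left_diff_distrib right_diff_distrib
    using zero_le_power2 [of "l2_norm d (x' - m)"] by linarith
  then have "9 * \<rho>\<^sup>2 * ((gamma - 1) * sqdist x' + 2 * gamma * q) \<le> 9 * \<rho>\<^sup>2 * (gamma * ?D)"
    by (rule mult_left_mono) simp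
  also have "\<dots> \<le> 9 / 4 * (?C * ?D)"
  proof -
    have "4 * gamma \<le> (1 + gamma)\<^sup>2"
      using zero_le_power2 [of "1 - gamma"] by (simp add: power2_eq_square algebra_simps)
    then have "(9 / 4 * \<rho>\<^sup>2 * ?D) * (4 * gamma) \<le> (9 / 4 * \<rho>\<^sup>2 * ?D) * (1 + gamma)\<^sup>2"
      by (rule mult_left_mono) simp
    then show ?thesis by (simp add: mult_ac)
  qed
  moreover have "2 * (1 + gamma)\<^sup>2 * \<rho>\<^sup>2 * sqdist x' \<le> 2 * (?C * ?D)"
    using mult_left_mono [OF D', of "2 * ?C"] by simp
  ultimately have "(resid x')\<^sup>2 + potential x' phi' \<le> 4 * (?C * ?D) + 9 / 4 * (?C * ?D) + 2 * (?C * ?D)"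
    using om unfolding potential_def q_def [symmetric] by linarith
  also have "\<dots> \<le> 9 * (?C * ?D)"
    by simp
  finally show ?thesis by (simp add: mult_ac)
qed

text \<open>
  While the residual stays above \<open>\<epsilon>\<close>, every iteration takes at least \<open>\<epsilon>\<^sup>2\<close> out of the budget
  granted by the first one.
\<close>

lemma small_residual_or_potential:
  assumes eps: "0 < \<epsilon>"
  shows "(\<exists>j x phi. j \<le> Suc k \<and> lamm d L (const_vec d lam) gamma phi0 j x phi \<and> resid x \<le> \<epsilon>) \<or>
    (\<exists>x phi. lamm d L (const_vec d lam) gamma phi0 (Suc k) x phi \<and> in_range x phi \<and>
      real (Suc k) * \<epsilon>\<^sup>2 + potential x phi \<le> 9 * (1 + gamma)\<^sup>2 * \<rho>\<^sup>2 * (l2_norm d m)\<^sup>2)"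
proof (induction k)
  case 0
  have "phi0 \<le> gamma * \<rho>"
    using phi0 gamma mult_mono [of 1 gamma phi0 \<rho>] by simp
  then have inr: "in_range 0 phi0"
    using l2_norm_minus_commute [of d 0 m] by (simp add: in_range_def)
  obtain phi' where run: "lamm d L (const_vec d lam) gamma phi0 (Suc 0) (step lam phi' 0) phi'"
    and maj: "majorizes d L (const_vec d lam) 0 phi'" and phi': "phi0 \<le> phi'" "phi' \<le> gamma * \<rho>"
    using inner_search_terminates [OF lamm.init inr] by metis
  show ?case
  proof (cases "resid (step lam phi' 0) \<le> \<epsilon>")
    case True
    then show ?thesis using run by blast
  next
    case False
    then have "\<epsilon>\<^sup>2 \<le> (resid (step lam phi' 0))\<^sup>2"
      using eps by (intro power_mono) auto
    then show ?thesis
      using potential_first [OF phi' maj] run accepted_step(1) [OF inr phi' maj]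
      by (intro disjI2 exI [of _ "step lam phi' 0"] exI [of _ phi']) simp
  qed
next
  case (Suc k)
  then show ?case
  proof
    assume "\<exists>j x phi. j \<le> Suc k \<and> lamm d L (const_vec d lam) gamma phi0 j x phi \<and> resid x \<le> \<epsilon>"
    then show ?thesis using le_SucI by blast
  next
    assume "\<exists>x phi. lamm d L (const_vec d lam) gamma phi0 (Suc k) x phi \<and> in_range x phi \<and>
      real (Suc k) * \<epsilon>\<^sup>2 + potential x phi \<le> 9 * (1 + gamma)\<^sup>2 * \<rho>\<^sup>2 * (l2_norm d m)\<^sup>2"
    then obtain x phi where run: "lamm d L (const_vec d lam) gamma phi0 (Suc k) x phi"
      and inr: "in_range x phi"
      and pot: "real (Suc k) * \<epsilon>\<^sup>2 + potential x phi \<le> 9 * (1 + gamma)\<^sup>2 * \<rho>\<^sup>2 * (l2_norm d m)\<^sup>2"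
      by blast
    obtain phi' where run': "lamm d L (const_vec d lam) gamma phi0 (Suc (Suc k)) (step lam phi' x) phi'"
      and maj: "majorizes d L (const_vec d lam) x phi'"
      and phi': "phi0 \<le> phi'" "phi' \<le> gamma * \<rho>" "phi \<le> gamma * phi'"
      using inner_search_terminates [OF run inr] by metis
    show ?thesis
    proof (cases "resid (step lam phi' x) \<le> \<epsilon>")
      case True
      then show ?thesis using run' by blast
    next
      case False
      then have "\<epsilon>\<^sup>2 \<le> (resid (step lam phi' x))\<^sup>2"
        using eps by (intro power_mono) auto
      then show ?thesis
        using potential_decrease [OF inr phi' maj] pot run' accepted_step(1) [OF inr phi'(1,2) maj]
        by (intro disjI2 exI [of _ "step lam phi' x"] exI [of _ phi']) (simp add: algebra_simps)
    qed
  qed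
qed

text \<open>
  With \<open>B\<close> the claimed bound, \<open>n = floor B\<close> iterations with residuals above \<open>\<epsilon>\<close> would need
  \<open>n * \<epsilon>\<^sup>2\<close> to be at most a quarter of \<open>B * \<epsilon>\<^sup>2\<close>, while \<open>n \<ge> B / 2\<close> as soon as \<open>B \<ge> 1\<close>. For
  \<open>B < 1\<close> no iteration is allowed; then the gradient varies so little between the origin and
  the minimizer that the origin itself is good enough.
\<close>

lemma iteration_bound:
  assumes eps: "0 < \<epsilon>" and R: "6 * l2_norm d m \<le> R"
  shows "\<exists>k x phi. lamm d L (const_vec d lam) gamma phi0 k x phi \<and> resid x \<le> \<epsilon> \<and>
    real k \<le> ((1 + gamma) * R * \<rho> / \<epsilon>)\<^sup>2"
proof -
  define B where "B = ((1 + gamma) * R * \<rho> / \<epsilon>)\<^sup>2"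
  have R0: "0 \<le> R"
    using R l2_norm_nonneg [of d m] by linarith
  show ?thesis
  proof (cases "B < 1")
    case True
    then have "\<bar>(1 + gamma) * R * \<rho> / \<epsilon>\<bar> < 1"
      unfolding B_def by (simp only: abs_square_less_1)
    then have "(1 + gamma) * R * \<rho> / \<epsilon> < 1"
      by linarith
    then have small: "(1 + gamma) * R * \<rho> < \<epsilon>"
      using eps by simp
    have zero: "0 \<in> Rd d" "l2_norm d (0 - m) = l2_norm d m"
      using l2_norm_minus_commute [of d 0 m] by auto
    then have "0 \<in> B2 d Q bstar" "m \<in> B2 d Q bstar"
      using near_minimizer [of 0] by auto
    then have "l2_norm d (G 0 - G m) \<le> \<rho> * l2_norm d (0 - m)"
      using lip by blast
    also have "\<dots> \<le> (1 + gamma) * R * \<rho>"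
    proof -
      have "1 * l2_norm d m \<le> (1 + gamma) * R"
        using gamma R l2_norm_nonneg [of d m] by (intro mult_mono) linarith+
      then show ?thesis
        using rho_pos zero by (simp add: mult.commute)
    qed
    finally have "resid 0 \<le> \<epsilon>"
      using omega_zero_le [OF d m min lam] small by simp
    then show ?thesis
      using lamm.init by (intro exI [of _ 0] exI [of _ phi0]) simp
  next
    case False
    define n where "n = nat \<lfloor>B\<rfloor>"
    have n: "real n \<le> B" "B < real n + 1" "1 \<le> n"
      using False by (auto simp: n_def le_nat_iff le_floor_iff)
    then obtain k where k: "n = Suc k" by (cases n) auto
    have "9 * (1 + gamma)\<^sup>2 * \<rho>\<^sup>2 * (l2_norm d m)\<^sup>2 < real n * \<epsilon>\<^sup>2"
    proof -
      have "(6 * l2_norm d m)\<^sup>2 \<le> R\<^sup>2"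
        using R by (intro power_mono) auto
      then have "(1 + gamma)\<^sup>2 * \<rho>\<^sup>2 * (36 * (l2_norm d m)\<^sup>2) \<le> (1 + gamma)\<^sup>2 * \<rho>\<^sup>2 * R\<^sup>2"
        by (intro mult_left_mono) (auto simp: power_mult_distrib)
      also have "\<dots> = B * \<epsilon>\<^sup>2"
        using eps by (simp add: B_def power_mult_distrib power_divide)
      finally have "4 * (9 * (1 + gamma)\<^sup>2 * \<rho>\<^sup>2 * (l2_norm d m)\<^sup>2) \<le> B * \<epsilon>\<^sup>2"
        by (simp add: mult_ac)
      also have "\<dots> < (4 * real n) * \<epsilon>\<^sup>2"
        using n eps by (intro mult_strict_right_mono) auto
      finally show ?thesis by linarith
    qed
    then have "\<not> (\<exists>x phi. in_range x phi \<and>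
        real (Suc k) * \<epsilon>\<^sup>2 + potential x phi \<le> 9 * (1 + gamma)\<^sup>2 * \<rho>\<^sup>2 * (l2_norm d m)\<^sup>2)"
      unfolding k [symmetric] by (auto dest: potential_nonneg)
    then obtain j x phi where "j \<le> Suc k" "lamm d L (const_vec d lam) gamma phi0 j x phi" "resid x \<le> \<epsilon>"
      using small_residual_or_potential [OF eps, of k] by blast
    moreover have "real j \<le> B"
      using \<open>j \<le> Suc k\<close> n k by simp
    ultimately show ?thesis
      unfolding B_def by blast
  qed
qed

end


section \<open>The iteration bound\<close>

theorem proposition4p5:
  shows "\<exists>(C_LSE :: real) (c_LSE :: real \<Rightarrow> real \<Rightarrow> real) (c0 :: real \<Rightarrow> real) (K :: real \<Rightarrow> real).
    C_LSE > 0 \<and>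
    (\<forall>rho_lo rho_up :: real. 0 < rho_lo \<longrightarrow> rho_lo \<le> rho_up \<longrightarrow>
      c_LSE rho_lo rho_up > 0 \<and> c0 rho_lo > 0 \<and> K rho_lo > 0 \<and>
      (\<forall>(d :: nat) (L :: rvec \<Rightarrow> real) (bstar :: rvec) (s :: nat)
          (r :: real) (lam :: real) (R :: real) (rho_c :: real) (eps_c :: real)
          (gamma_u :: real) (phi0 :: real).
        bstar \<in> Rd d \<longrightarrow>
        s = card (supp bstar) \<longrightarrow> s \<ge> 1 \<longrightarrow>
        admissible_loss d L bstar r \<longrightarrow>
        LSE d L bstar rho_lo rho_up (c_LSE rho_lo rho_up) C_LSE r \<longrightarrow>
        lam > 0 \<longrightarrow>
        R = K rho_lo * (l2_norm d bstar + lam * sqrt (real s)) \<longrightarrow>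
        (\<forall>b1 \<in> B2 d (R / 2) bstar. \<forall>b2 \<in> B2 d (R / 2) bstar.
           l2_norm d (grad d L b1 - grad d L b2) \<le> rho_c * l2_norm d (b1 - b2)) \<longrightarrow>
        eps_c > 0 \<longrightarrow>
        4 * (linf_norm d (grad d L bstar) + eps_c) \<le> lam \<longrightarrow>
        lam \<le> c0 rho_lo * r / sqrt (real s) \<longrightarrow>
        gamma_u > 1 \<longrightarrow>
        0 < phi0 \<longrightarrow> phi0 \<le> rho_c \<longrightarrow>
        (\<exists>k x phi.
           lamm d L (const_vec d lam) gamma_u phi0 k x phi \<and>
           omega d L (const_vec d lam) x \<le> eps_c \<and>
           real k \<le> ((1 + gamma_u) * R * rho_c / eps_c)\<^sup>2)))"
proof -
  \<comment> \<open>With \<open>E\<close> below the distance bound for the minimizer, \<open>K\<close> is chosen such that \<open>R / 2\<close> is at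
    least \<open>2 * (l2_norm bstar + E) + E\<close>, the reach of a trial step, and \<open>R\<close> at least six times
    \<open>l2_norm bstar + E\<close>. The constant \<open>1 / 25\<close> in the bound on \<open>lam\<close> makes \<open>E < r\<close>, as \<open>E\<close> is
    \<open>22.5 * lam * sqrt s / rho_lo\<close>.\<close>
  define K where "K lo = 6 + 135 / lo" for lo :: real
  have main: "\<exists>k x phi. lamm d L (const_vec d lam) gamma_u phi0 k x phi \<and>
      omega d L (const_vec d lam) x \<le> eps_c \<and> real k \<le> ((1 + gamma_u) * R * rho_c / eps_c)\<^sup>2"
    if rho: "0 < rho_lo" "rho_lo \<le> rho_up"
      and b: "bstar \<in> Rd d" and s: "s = card (supp bstar)" "1 \<le> s"
      and adm: "admissible_loss d L bstar r"
      and lse: "LSE d L bstar rho_lo rho_up (144 * rho_up / rho_lo) 1 r"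
      and lam: "0 < lam" and R: "R = K rho_lo * (l2_norm d bstar + lam * sqrt (real s))"
      and lip: "\<forall>b1\<in>B2 d (R / 2) bstar. \<forall>b2\<in>B2 d (R / 2) bstar.
        l2_norm d (grad d L b1 - grad d L b2) \<le> rho_c * l2_norm d (b1 - b2)"
      and eps: "0 < eps_c" and reg: "4 * (linf_norm d (grad d L bstar) + eps_c) \<le> lam"
      and loc: "lam \<le> rho_lo / 25 * r / sqrt (real s)"
      and gamma: "1 < gamma_u" and phi0: "0 < phi0" "phi0 \<le> rho_c"
    for d L bstar s r lam R rho_c eps_c gamma_u phi0 rho_lo rho_up
  proof -
    interpret smooth_convex d L
      using adm by unfold_locales (simp_all add: admissible_loss_def)
    have tw: "\<And>x. x \<in> B2 d r bstar \<Longrightarrow> grad d L differentiable (at x within Rd d)"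
      using adm by (simp add: admissible_loss_def)
    have S: "supp bstar \<noteq> {}" using s by auto
    then have d: "0 < d"
      using b by (cases d) (auto simp: Rd_def)
    define E where "E = 45 / 2 * lam * sqrt (real s) / rho_lo"
    have s0: "0 < sqrt (real s)" using s by simp
    have "lam * sqrt (real s) \<le> rho_lo / 25 * r"
      using loc s0 by (simp add: pos_le_divide_eq)
    then have "25 * (lam * sqrt (real s)) / rho_lo \<le> r"
      using rho by (simp add: field_simps)
    moreover have "E < 25 * (lam * sqrt (real s)) / rho_lo"
      using lam s0 rho by (simp add: E_def field_simps)
    ultimately have E: "E < r" by simp
    obtain m where m: "m \<in> Rd d" "l2_norm d (m - bstar) \<le> E"
      and min: "\<And>x. x \<in> Rd d \<Longrightarrow> F lam m \<le> F lam x"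
      using exists_minimizer_near_target [OF b refl S lam _ tw rho lse] E reg eps
      unfolding E_def s by auto
    have norm_m: "l2_norm d m \<le> l2_norm d bstar + E"
      using l2_norm_triangle [of d "m - bstar" bstar] m by simp
    have R_eq: "R = 6 * l2_norm d bstar + 135 / rho_lo * l2_norm d bstar
        + 6 * (lam * sqrt (real s)) + 6 * E"
      by (simp add: R K_def E_def algebra_simps add_divide_distrib)
    have pos: "0 \<le> 135 / rho_lo * l2_norm d bstar" "0 \<le> lam * sqrt (real s)" "0 \<le> l2_norm d bstar"
      using rho lam by auto
    have near: "x \<in> B2 d (R / 2) bstar"
      if x: "x \<in> Rd d" "l2_norm d (x - m) \<le> 2 * l2_norm d m" for x
    proof -
      have "l2_norm d (x - bstar) \<le> l2_norm d (x - m) + l2_norm d (m - bstar)"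
        by (rule l2_norm_diff_triangle)
      also have "\<dots> \<le> R / 2"
        using x m norm_m R_eq pos by linarith
      finally show ?thesis using x by (simp add: B2_def)
    qed
    interpret lamm_setting d L bstar m "R / 2" lam rho_c gamma_u phi0
      by unfold_locales (fact d lam gamma phi0 m(1) min near lip)+
    show ?thesis
      using norm_m R_eq pos by (intro iteration_bound eps) linarith
  qed
  show ?thesis
  proof (rule exI [of _ 1], rule exI [of _ "\<lambda>lo up. 144 * up / lo"],
      rule exI [of _ "\<lambda>lo. lo / 25"], rule exI [of _ K], intro conjI allI impI, goal_cases)
    case (4 rho_lo rho_up)
    then have "0 < 135 / rho_lo" by simp
    then show ?case unfolding K_def by linarith
  next
    case 5
    show ?case by (rule main; fact)
  qed simp_all
qed

end
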